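(* The following classes of algebras of type $\langle 2,2,1\rangle$ coincide: (1) $\mathcal{BDMBL}$; (2) $Bip(\mathcal{DML})$; (3) $V(\mathbf{DM}_4,\mathbf{IS}_3)$; (4) the class of (isomorphic images of) De Morgan–Płonka sums of distributive lattices over involutive semilattices belonging to $V(\mathbf{IS}_3)$.
   Context: A De Morgan bisemilattice is an algebra $\langle B,\land,\lor,\lnot\rangle$ such that $\langle B,\land\rangle$, $\langle B,\lor\rangle$ are semilattices, each of $\land,\lor$ distributes over the other, and $\lnot\lnot x\approx x$, $\lnot(x\land y)\approx\lnot x\lor\lnot y$, $\lnot(x\lor y)\approx\lnot x\land\lnot y$ hold; $\mathcal{DMBL}$ is their variety. $\mathcal{BDMBL}$ is the subvariety of $\mathcal{DMBL}$ axiomatised by $x\land(x\lor\lnot x)\approx x\land(x\lor\lnot x)\land(x\lor\lnot x\lor y)$. $\mathcal{DML}$ is the variety of De Morgan lattices (De Morgan bisemilattices that are distributive lattices). $\mathbf{DM}_4$ is the De Morgan lattice with universe $\{\mathbf{t},\mathbf{f},\top,\bot\}$, lattice order $\mathbf{f}<\top,\bot<\mathbf{t}$ ($\top,\bot$ incomparable), $\lnot\mathbf{t}=\mathbf{f}$, $\lnot\top=\top$, $\lnot\bot=\bot$. An involutive semilattice $\langle I,\lor,\lnot\rangle$ is a semilattice with $\lnot\lnot x\approx x$, $\lnot(x\lor y)\approx\lnot x\lor\lnot y$; viewed as type $\langle 2,2,1\rangle$ by setting $x\land y:=x\lor y$. $\mathbf{IS}_3$ is the involutive semilattice $\{\mathbf{i},\lnot\mathbf{i},\mathbf{j}\}$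 with $\mathbf{i}\ne\lnot\mathbf{i}$, $\lnot\mathbf{j}=\mathbf{j}$ top, $\mathbf{i}\lor\lnot\mathbf{i}=\mathbf{j}$. $V(\mathcal{K})$ is the variety generated by $\mathcal{K}$. For a term $\varphi$, $Var^{+}(\varphi)$ (resp. $Var^{-}(\varphi)$) is the set of variables with an occurrence in the scope of an even (resp. odd) number of $\lnot$'s. An identity $\varphi\approx\psi$ is balanced regular if $Var^\pm(\varphi)=Var^\pm(\psi)$; bipolar if $Var^+(\varphi)\cap Var^-(\varphi)\ne\emptyset$ and $Var^+(\psi)\cap Var^-(\psi)\ne\emptyset$; bipolarly balanced if bipolar or balanced regular. For a variety $\mathcal{V}$, $Bip(\mathcal{V})$ is the variety satisfying all and only the bipolarly balanced identities valid in $\mathcal{V}$. An involutive semilattice direct system of distributive lattices consists of an involutive semilattice $\mathbf{I}$ (with order $\le$), distributive lattices $F(i)$ ($i\in I$) with pairwise disjoint universes, lattice homomorphisms $p_{ij}:F(i)\to F(j)$ for $i\le j$ with $p_{ii}=\mathrm{id}$ and $p_{jk}\circ p_{ij}=p_{ik}$, and bijections $n_i:F(i)\to F(\lnot i)$ which are lattice isomorphisms onto the order-dual of $F(\lnot i)$ (interchanging $\land$ and $\lor$), with $n_{\lnot i}=n_i^{-1}$ and $n_j\circ p_{ij}=p_{\lnot i,\lnot j}\circ n_i$ for $i\le j$. Its De Morgan–Płonka sum $\mathrm{DP\l}(F)$ has universe $\bigsqcup_{i}F(i)$, $a\land b=p_{ik}(a)\land^{F(k)}p_{jk}(b)$ and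 $a\lor b=p_{ik}(a)\lor^{F(k)}p_{jk}(b)$ for $a\in F(i)$, $b\in F(j)$, $k=i\lor j$, and $\lnot a=n_i(a)$ for $a\in F(i)$; $\mathbf{I}$ is its underlying involutive semilattice. *)

theory Defs
  imports Main "HOL-Library.Disjoint_Sets" "HOL-Library.Infinite_Typeclass"
begin

section \<open>Algebras\<close>

text \<open>
  Universes of algebras are nonempty sets. Only the restriction of the operations to the universe
  is relevant.
\<close>

record 'a lat =
  univ :: "'a set"
  meet :: "'a \<Rightarrow> 'a \<Rightarrow> 'a" (infixl "\<sqinter>\<index>" 70)
  join :: "'a \<Rightarrow> 'a \<Rightarrow> 'a" (infixl "\<squnion>\<index>" 65)

record 'a alg = "'a lat" +
  neg :: "'a \<Rightarrow> 'a" ("\<sim>\<index> _" [81] 80)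

locale algebra22 =
  fixes A :: "('a, 'z) lat_scheme" (structure)
  assumes univ_nonempty: "univ A \<noteq> {}"
    and meet_closed: "\<lbrakk>x \<in> univ A; y \<in> univ A\<rbrakk> \<Longrightarrow> x \<sqinter> y \<in> univ A"
    and join_closed: "\<lbrakk>x \<in> univ A; y \<in> univ A\<rbrakk> \<Longrightarrow> x \<squnion> y \<in> univ A"

locale algebra221 = algebra22 A for A :: "'a alg" (structure) +
  assumes neg_closed: "x \<in> univ A \<Longrightarrow> \<sim> x \<in> univ A"

definition semilattice_on :: "'a set \<Rightarrow> ('a \<Rightarrow> 'a \<Rightarrow> 'a) \<Rightarrow> bool" where
  "semilattice_on B f \<longleftrightarrow>
     (\<forall>x\<in>B. f x x = x) \<and>
     (\<forall>x\<in>B. \<forall>y\<in>B. f x y = f y x) \<and>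
     (\<forall>x\<in>B. \<forall>y\<in>B. \<forall>z\<in>B. f (f x y) z = f x (f y z))"

locale distributive_bisemilattice = algebra22 A for A :: "('a, 'z) lat_scheme" (structure) +
  assumes meet_semilattice: "semilattice_on (univ A) (meet A)"
    and join_semilattice: "semilattice_on (univ A) (join A)"
    and meet_join_distrib: "\<lbrakk>x \<in> univ A; y \<in> univ A; z \<in> univ A\<rbrakk> \<Longrightarrow>
          x \<sqinter> (y \<squnion> z) = (x \<sqinter> y) \<squnion> (x \<sqinter> z)"
    and join_meet_distrib: "\<lbrakk>x \<in> univ A; y \<in> univ A; z \<in> univ A\<rbrakk> \<Longrightarrow>
          x \<squnion> (y \<sqinter> z) = (x \<squnion> y) \<sqinter> (x \<squnion> z)"

locale distributive_lattice = distributive_bisemilattice A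
    for A :: "('a, 'z) lat_scheme" (structure) +
  assumes meet_join_absorb: "\<lbrakk>x \<in> univ A; y \<in> univ A\<rbrakk> \<Longrightarrow> x \<sqinter> (x \<squnion> y) = x"
    and join_meet_absorb: "\<lbrakk>x \<in> univ A; y \<in> univ A\<rbrakk> \<Longrightarrow> x \<squnion> (x \<sqinter> y) = x"

locale de_morgan_bisemilattice = algebra221 A + distributive_bisemilattice A
    for A :: "'a alg" (structure) +
  assumes neg_neg: "x \<in> univ A \<Longrightarrow> \<sim> (\<sim> x) = x"
    and neg_meet: "\<lbrakk>x \<in> univ A; y \<in> univ A\<rbrakk> \<Longrightarrow> \<sim> (x \<sqinter> y) = \<sim> x \<squnion> \<sim> y"
    and neg_join: "\<lbrakk>x \<in> univ A; y \<in> univ A\<rbrakk> \<Longrightarrow> \<sim> (x \<squnion> y) = \<sim> x \<sqinter> \<sim> y"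

definition DMBL :: "'a alg set" where
  "DMBL = {A. de_morgan_bisemilattice A}"

definition BDMBL :: "'a alg set" where
  "BDMBL = {A \<in> DMBL. \<forall>x\<in>univ A. \<forall>y\<in>univ A.
     x \<sqinter>\<^bsub>A\<^esub> (x \<squnion>\<^bsub>A\<^esub> \<sim>\<^bsub>A\<^esub> x) =
     x \<sqinter>\<^bsub>A\<^esub> (x \<squnion>\<^bsub>A\<^esub> \<sim>\<^bsub>A\<^esub> x) \<sqinter>\<^bsub>A\<^esub> (x \<squnion>\<^bsub>A\<^esub> \<sim>\<^bsub>A\<^esub> x \<squnion>\<^bsub>A\<^esub> y)}"

definition DML :: "'a alg set" where
  "DML = {A \<in> DMBL. distributive_lattice A}"

text \<open>Involutive semilattices are given directly in the type with two copies of the join.\<close>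

locale involutive_semilattice = algebra221 I for I :: "'a alg" (structure) +
  assumes join_semilattice: "semilattice_on (univ I) (join I)"
    and meet_eq_join: "\<lbrakk>x \<in> univ I; y \<in> univ I\<rbrakk> \<Longrightarrow> x \<sqinter> y = x \<squnion> y"
    and neg_neg: "x \<in> univ I \<Longrightarrow> \<sim> (\<sim> x) = x"
    and neg_join: "\<lbrakk>x \<in> univ I; y \<in> univ I\<rbrakk> \<Longrightarrow> \<sim> (x \<squnion> y) = \<sim> x \<squnion> \<sim> y"

definition isomorphic :: "'a alg \<Rightarrow> 'b alg \<Rightarrow> bool" where
  "isomorphic A B \<longleftrightarrow> (\<exists>h. bij_betw h (univ A) (univ B) \<and>
     (\<forall>x\<in>univ A. \<forall>y\<in>univ A. h (x \<sqinter>\<^bsub>A\<^esub> y) = h x \<sqinter>\<^bsub>B\<^esub> h y) \<and>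
     (\<forall>x\<in>univ A. \<forall>y\<in>univ A. h (x \<squnion>\<^bsub>A\<^esub> y) = h x \<squnion>\<^bsub>B\<^esub> h y) \<and>
     (\<forall>x\<in>univ A. h (\<sim>\<^bsub>A\<^esub> x) = \<sim>\<^bsub>B\<^esub> (h x)))"


section \<open>The generating algebras\<close>

text \<open>
  One type holds both universes, so that the two algebras can be put into one set.
  \<open>Tp\<close> and \<open>Bt\<close> are the incomparable fixed points of negation in the four-element algebra.
\<close>

datatype val = Tr | Fa | Tp | Bt | II | NI | JJ

fun val_neg :: "val \<Rightarrow> val" where
  "val_neg Tr = Fa"
| "val_neg Fa = Tr"
| "val_neg Tp = Tp"
| "val_neg Bt = Bt"
| "val_neg II = NI"
| "val_neg NI = II"
| "val_neg JJ = JJ"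

definition DM4 :: "val alg" where
  "DM4 = \<lparr>univ = {Tr, Fa, Tp, Bt},
     meet = (\<lambda>x y. if x = y then x else if x = Tr then y else if y = Tr then x else Fa),
     join = (\<lambda>x y. if x = y then x else if x = Fa then y else if y = Fa then x else Tr),
     neg = val_neg\<rparr>"

definition IS3 :: "val alg" where
  "IS3 = \<lparr>univ = {II, NI, JJ},
     meet = (\<lambda>x y. if x = y then x else JJ),
     join = (\<lambda>x y. if x = y then x else JJ),
     neg = val_neg\<rparr>"


section \<open>Identities and varieties\<close>

datatype trm = Var nat | Meet trm trm | Join trm trm | Neg trm

primrec eval :: "'a alg \<Rightarrow> (nat \<Rightarrow> 'a) \<Rightarrow> trm \<Rightarrow> 'a" where
  "eval A v (Var n) = v n"
| "eval A v (Meet s t) = eval A v s \<sqinter>\<^bsub>A\<^esub> eval A v t"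
| "eval A v (Join s t) = eval A v s \<squnion>\<^bsub>A\<^esub> eval A v t"
| "eval A v (Neg t) = \<sim>\<^bsub>A\<^esub> (eval A v t)"

text \<open>The identity \<open>s \<approx> t\<close> is the pair \<open>(s, t)\<close>.\<close>

type_synonym identity = "trm \<times> trm"

definition satisfies :: "'a alg \<Rightarrow> identity \<Rightarrow> bool" where
  "satisfies A e \<longleftrightarrow> (\<forall>v. range v \<subseteq> univ A \<longrightarrow> eval A v (fst e) = eval A v (snd e))"

text \<open>
  A variety is an equational class. It is represented by a set of identities, and
  \<open>models E\<close> collects those of its members whose universe lies in a given type.
\<close>

definition models :: "identity set \<Rightarrow> 'a alg set" where
  "models E = {A. algebra221 A \<and> (\<forall>e\<in>E. satisfies A e)}"

text \<open>The least variety containing \<open>K\<close>. The types of \<open>K\<close> and of the resulting class may differ.\<close>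

definition generated_variety :: "'b alg set \<Rightarrow> 'a alg set" where
  "generated_variety K = \<Inter> {models E | E. K \<subseteq> models E}"

fun Var_pos :: "trm \<Rightarrow> nat set" and Var_neg :: "trm \<Rightarrow> nat set" where
  "Var_pos (Var n) = {n}"
| "Var_pos (Meet s t) = Var_pos s \<union> Var_pos t"
| "Var_pos (Join s t) = Var_pos s \<union> Var_pos t"
| "Var_pos (Neg t) = Var_neg t"
| "Var_neg (Var n) = {}"
| "Var_neg (Meet s t) = Var_neg s \<union> Var_neg t"
| "Var_neg (Join s t) = Var_neg s \<union> Var_neg t"
| "Var_neg (Neg t) = Var_pos t"

definition balanced_regular :: "identity \<Rightarrow> bool" where
  "balanced_regular e \<longleftrightarrow>
     Var_pos (fst e) = Var_pos (snd e) \<and> Var_neg (fst e) = Var_neg (snd e)"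

definition bipolar :: "identity \<Rightarrow> bool" where
  "bipolar e \<longleftrightarrow>
     Var_pos (fst e) \<inter> Var_neg (fst e) \<noteq> {} \<and> Var_pos (snd e) \<inter> Var_neg (snd e) \<noteq> {}"

definition bipolarly_balanced :: "identity \<Rightarrow> bool" where
  "bipolarly_balanced e \<longleftrightarrow> bipolar e \<or> balanced_regular e"

text \<open>
  The class \<open>V\<close> has to be taken in an infinite type for \<open>Bip\<close> to be the intended variety:
  an identity that fails in some member of a variety fails in a finitely generated, hence
  countable, member, and every infinite type contains a copy of that one.
\<close>

definition Bip :: "'b::infinite alg set \<Rightarrow> 'a alg set" where
  "Bip V = models {e. bipolarly_balanced e \<and> (\<forall>A\<in>V. satisfies A e)}"


section \<open>De Morgan--Plonka sums\<close>

record ('i, 'b) system =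
  index :: "'i alg"
  fibre :: "'i \<Rightarrow> 'b lat"
  trans_map :: "'i \<Rightarrow> 'i \<Rightarrow> 'b \<Rightarrow> 'b"
  neg_map :: "'i \<Rightarrow> 'b \<Rightarrow> 'b"

definition index_le :: "('i, 'b) system \<Rightarrow> 'i \<Rightarrow> 'i \<Rightarrow> bool" where
  "index_le S i j \<longleftrightarrow> i \<in> univ (index S) \<and> j \<in> univ (index S) \<and> i \<squnion>\<^bsub>index S\<^esub> j = j"

definition lattice_hom :: "'b lat \<Rightarrow> 'c lat \<Rightarrow> ('b \<Rightarrow> 'c) \<Rightarrow> bool" where
  "lattice_hom L M h \<longleftrightarrow> h ` univ L \<subseteq> univ M \<and>
     (\<forall>x\<in>univ L. \<forall>y\<in>univ L. h (x \<sqinter>\<^bsub>L\<^esub> y) = h x \<sqinter>\<^bsub>M\<^esub> h y) \<and>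
     (\<forall>x\<in>univ L. \<forall>y\<in>univ L. h (x \<squnion>\<^bsub>L\<^esub> y) = h x \<squnion>\<^bsub>M\<^esub> h y)"

definition dual_lat :: "'b lat \<Rightarrow> 'b lat" where
  "dual_lat L = \<lparr>univ = univ L, meet = join L, join = meet L\<rparr>"

locale direct_system =
  fixes S :: "('i, 'b) system"
  assumes index: "involutive_semilattice (index S)"
    and fibre: "i \<in> univ (index S) \<Longrightarrow> distributive_lattice (fibre S i)"
    and disjoint: "disjoint_family_on (\<lambda>i. univ (fibre S i)) (univ (index S))"
    and trans_hom: "index_le S i j \<Longrightarrow> lattice_hom (fibre S i) (fibre S j) (trans_map S i j)"
    and trans_id: "\<lbrakk>i \<in> univ (index S); x \<in> univ (fibre S i)\<rbrakk> \<Longrightarrow> trans_map S i i x = x"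
    and trans_comp: "\<lbrakk>index_le S i j; index_le S j k; x \<in> univ (fibre S i)\<rbrakk> \<Longrightarrow>
          trans_map S j k (trans_map S i j x) = trans_map S i k x"
    and neg_bij: "i \<in> univ (index S) \<Longrightarrow>
          bij_betw (neg_map S i) (univ (fibre S i)) (univ (fibre S (\<sim>\<^bsub>index S\<^esub> i)))"
    and neg_hom: "i \<in> univ (index S) \<Longrightarrow>
          lattice_hom (fibre S i) (dual_lat (fibre S (\<sim>\<^bsub>index S\<^esub> i))) (neg_map S i)"
    and neg_inverse: "\<lbrakk>i \<in> univ (index S); x \<in> univ (fibre S i)\<rbrakk> \<Longrightarrow>
          neg_map S (\<sim>\<^bsub>index S\<^esub> i) (neg_map S i x) = x"
    and neg_trans: "\<lbrakk>index_le S i j; x \<in> univ (fibre S i)\<rbrakk> \<Longrightarrow>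
          neg_map S j (trans_map S i j x) =
          trans_map S (\<sim>\<^bsub>index S\<^esub> i) (\<sim>\<^bsub>index S\<^esub> j) (neg_map S i x)"

definition index_of :: "('i, 'b) system \<Rightarrow> 'b \<Rightarrow> 'i" where
  "index_of S a = (THE i. i \<in> univ (index S) \<and> a \<in> univ (fibre S i))"

definition DP_sum :: "('i, 'b) system \<Rightarrow> 'b alg" where
  "DP_sum S = \<lparr>
     univ = (\<Union>i\<in>univ (index S). univ (fibre S i)),
     meet = (\<lambda>a b. let i = index_of S a; j = index_of S b; k = i \<squnion>\<^bsub>index S\<^esub> j
       in trans_map S i k a \<sqinter>\<^bsub>fibre S k\<^esub> trans_map S j k b),
     join = (\<lambda>a b. let i = index_of S a; j = index_of S b; k = i \<squnion>\<^bsub>index S\<^esub> j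
       in trans_map S i k a \<squnion>\<^bsub>fibre S k\<^esub> trans_map S j k b),
     neg = (\<lambda>a. neg_map S (index_of S a) a)\<rparr>"

text \<open>
  HOL cannot quantify over the types of indices and of fibre elements inside a formula, so they
  are parameters. An algebra with universe in \<open>'a\<close> that is isomorphic to a sum over any types is
  also isomorphic to one with both parameters equal to \<open>'a\<close>: transport the fibres along the
  isomorphism, and rename each index to some element of its (nonempty) fibre.
\<close>

definition DP_sums :: "'i itself \<Rightarrow> 'b itself \<Rightarrow> 'a alg set" where
  "DP_sums _ _ = {A. \<exists>S :: ('i, 'b) system.
     direct_system S \<and> index S \<in> generated_variety {IS3} \<and> isomorphic (DP_sum S) A}"

end

theory Submission
  imports Defs
begin

text \<open>
  In a distributive bisemilattice, \<open>x \<rhd> y = x \<sqinter> (x \<squnion> y)\<close> is a Plonka partition operation: it moves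
  \<open>x\<close> into the fibre of the join of the indices of \<open>x\<close> and \<open>y\<close>. It commutes with negation, so a De
  Morgan bisemilattice is a De Morgan--Plonka sum over its involutive semilattice of indices, and
  the identity that defines \<open>BDMBL\<close> says that every \<open>i \<squnion> \<sim> i\<close> is the greatest index.

  Identities of \<open>IS3\<close> are exactly the bipolarly balanced ones, so two sides of such an identity take
  values in the same fibre of a sum over an index in the variety of \<open>IS3\<close>. If the values
  differ, a prime filter of that fibre separates them. Reading each variable through the filter,
  once directly and once negated, gives a valuation in \<open>DM4\<close>, seen as the square of the
  two-element lattice with the twisted negation \<open>\<sim> (P, Q) = (\<not> Q, \<not> P)\<close>, and this valuation
  refutes the identity in \<open>DM4\<close>. Hence each of the four classes is axiomatised by the bipolarly
  balanced identities of \<open>DM4\<close>.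
\<close>

section \<open>The partition operation\<close>

context distributive_bisemilattice
begin

lemmas closed [simp] = meet_closed join_closed

lemma meet_idem [simp]: "x \<in> univ A \<Longrightarrow> x \<sqinter> x = x"
  and join_idem [simp]: "x \<in> univ A \<Longrightarrow> x \<squnion> x = x"
  using meet_semilattice join_semilattice by (simp_all add: semilattice_on_def)

lemma meet_comm: "\<lbrakk>x \<in> univ A; y \<in> univ A\<rbrakk> \<Longrightarrow> x \<sqinter> y = y \<sqinter> x"
  and join_comm: "\<lbrakk>x \<in> univ A; y \<in> univ A\<rbrakk> \<Longrightarrow> x \<squnion> y = y \<squnion> x"
  using meet_semilattice join_semilattice by (simp_all add: semilattice_on_def)

lemma meet_assoc: "\<lbrakk>x \<in> univ A; y \<in> univ A; z \<in> univ A\<rbrakk> \<Longrightarrow> x \<sqinter> y \<sqinter> z = x \<sqinter> (y \<sqinter> z)"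
  and join_assoc: "\<lbrakk>x \<in> univ A; y \<in> univ A; z \<in> univ A\<rbrakk> \<Longrightarrow> x \<squnion> y \<squnion> z = x \<squnion> (y \<squnion> z)"
  using meet_semilattice join_semilattice unfolding semilattice_on_def by blast+

lemma meet_left_comm:
  assumes "x \<in> univ A" "y \<in> univ A" "z \<in> univ A"
  shows "x \<sqinter> (y \<sqinter> z) = y \<sqinter> (x \<sqinter> z)"
  using assms by (metis meet_assoc meet_comm)

lemma join_left_comm:
  assumes "x \<in> univ A" "y \<in> univ A" "z \<in> univ A"
  shows "x \<squnion> (y \<squnion> z) = y \<squnion> (x \<squnion> z)"
  using assms by (metis join_assoc join_comm)

lemma meet_left_idem [simp]: "\<lbrakk>x \<in> univ A; y \<in> univ A\<rbrakk> \<Longrightarrow> x \<sqinter> (x \<sqinter> y) = x \<sqinter> y"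
  and join_left_idem [simp]: "\<lbrakk>x \<in> univ A; y \<in> univ A\<rbrakk> \<Longrightarrow> x \<squnion> (x \<squnion> y) = x \<squnion> y"
  by (simp_all flip: meet_assoc join_assoc)

lemmas meet_ac = meet_assoc meet_comm meet_left_comm
lemmas join_ac = join_assoc join_comm join_left_comm

lemma meet_join_distrib2:
  "\<lbrakk>x \<in> univ A; y \<in> univ A; z \<in> univ A\<rbrakk> \<Longrightarrow> (y \<squnion> z) \<sqinter> x = (y \<sqinter> x) \<squnion> (z \<sqinter> x)"
  by (simp add: meet_join_distrib meet_comm[of _ x])

lemma join_meet_distrib2:
  "\<lbrakk>x \<in> univ A; y \<in> univ A; z \<in> univ A\<rbrakk> \<Longrightarrow> (y \<sqinter> z) \<squnion> x = (y \<squnion> x) \<sqinter> (z \<squnion> x)"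
  by (simp add: join_meet_distrib join_comm[of _ x])

definition proj :: "'a \<Rightarrow> 'a \<Rightarrow> 'a" (infixl "\<rhd>" 72) where
  "x \<rhd> y = x \<sqinter> (x \<squnion> y)"

lemma proj_closed [simp]: "\<lbrakk>x \<in> univ A; y \<in> univ A\<rbrakk> \<Longrightarrow> x \<rhd> y \<in> univ A"
  by (simp add: proj_def)

text \<open>Distributing \<open>x \<squnion> (x \<sqinter> y)\<close> and using idempotence gives
  the meet form. With both forms at hand \<open>\<rhd>\<close> is self-dual: the first suits meets,
  the second joins, and negation will exchange them.\<close>

lemma proj_eq_join: "\<lbrakk>x \<in> univ A; y \<in> univ A\<rbrakk> \<Longrightarrow> x \<rhd> y = x \<squnion> (x \<sqinter> y)"
  by (simp add: proj_def join_meet_distrib)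

lemma proj_idem [simp]: "x \<in> univ A \<Longrightarrow> x \<rhd> x = x"
  by (simp add: proj_def)

text \<open>This and \<open>join_proj\<close> prepare the transition maps of the decomposition,
  which are restrictions of \<open>\<lambda>x. x \<rhd> z\<close>.\<close>

lemma meet_proj:
  assumes "x \<in> univ A" "y \<in> univ A" "z \<in> univ A"
  shows "(x \<sqinter> y) \<rhd> z = (x \<rhd> z) \<sqinter> (y \<rhd> z)"
  using assms by (simp add: proj_def join_meet_distrib2 meet_ac)

lemma join_proj:
  assumes "x \<in> univ A" "y \<in> univ A" "z \<in> univ A"
  shows "(x \<squnion> y) \<rhd> z = (x \<rhd> z) \<squnion> (y \<rhd> z)"
  using assms by (simp add: proj_eq_join meet_join_distrib2 join_ac)

text \<open>Since \<open>proj_join\<close> has the same right-hand side,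
  \<open>y \<sqinter> z\<close> and \<open>y \<squnion> z\<close> act alike on the right and so
  belong to one fibre.\<close>

lemma proj_meet:
  assumes [simp]: "x \<in> univ A" "y \<in> univ A" "z \<in> univ A"
  shows "x \<rhd> (y \<sqinter> z) = (x \<rhd> y) \<rhd> z"
proof -
  \<comment> \<open>Distributivity alone puts the meet below the join. The expansion of
    \<open>x \<rhd> y \<rhd> z\<close> contains the extra factor
    \<open>x \<squnion> (y \<squnion> z)\<close>, and this identity accounts for it.\<close>
  have yz: "y \<sqinter> z = y \<sqinter> z \<sqinter> (y \<squnion> z)"
  proof -
    have "y \<sqinter> z = (y \<sqinter> z) \<squnion> (y \<sqinter> z)" by simp
    also have "\<dots> = y \<sqinter> z \<sqinter> (y \<squnion> z)"
      by (simp add: meet_join_distrib meet_ac)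
    finally show ?thesis .
  qed
  have "x \<sqinter> (x \<squnion> y) \<squnion> z = (x \<squnion> z) \<sqinter> (x \<squnion> (y \<squnion> z))"
    by (simp add: join_meet_distrib2 join_assoc)
  then have "(x \<rhd> y) \<rhd> z = x \<sqinter> ((x \<squnion> y) \<sqinter> ((x \<squnion> z) \<sqinter> (x \<squnion> (y \<squnion> z))))"
    by (simp add: proj_def meet_assoc)
  also have "\<dots> = x \<sqinter> (x \<squnion> (y \<sqinter> z \<sqinter> (y \<squnion> z)))"
    by (simp add: join_meet_distrib meet_ac)
  also have "\<dots> = x \<rhd> (y \<sqinter> z)"
    using yz by (simp add: proj_def)
  finally show ?thesis ..
qed

lemma proj_join:
  assumes [simp]: "x \<in> univ A" "y \<in> univ A" "z \<in> univ A"
  shows "x \<rhd> (y \<squnion> z) = (x \<rhd> y) \<rhd> z"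
proof -
  have yz: "y \<squnion> z = y \<squnion> z \<squnion> (y \<sqinter> z)"
  proof -
    have "y \<squnion> z = (y \<squnion> z) \<sqinter> (y \<squnion> z)" by simp
    also have "\<dots> = y \<squnion> z \<squnion> (y \<sqinter> z)"
      by (simp add: join_meet_distrib join_ac)
    finally show ?thesis .
  qed
  have "(x \<squnion> x \<sqinter> y) \<sqinter> z = x \<sqinter> z \<squnion> x \<sqinter> (y \<sqinter> z)"
    by (simp add: meet_join_distrib2 meet_assoc)
  then have "(x \<rhd> y) \<rhd> z = x \<squnion> ((x \<sqinter> y) \<squnion> ((x \<sqinter> z) \<squnion> (x \<sqinter> (y \<sqinter> z))))"
    by (simp add: proj_eq_join join_assoc)
  also have "\<dots> = x \<squnion> (x \<sqinter> (y \<squnion> z \<squnion> (y \<sqinter> z)))"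
    by (simp add: meet_join_distrib join_ac)
  also have "\<dots> = x \<rhd> (y \<squnion> z)"
    using yz by (simp add: proj_eq_join)
  finally show ?thesis ..
qed

lemma proj_right_comm:
  assumes "x \<in> univ A" "y \<in> univ A" "z \<in> univ A"
  shows "x \<rhd> y \<rhd> z = x \<rhd> z \<rhd> y"
  using assms by (metis join_comm proj_join)

lemma proj_proj [simp]:
  assumes "x \<in> univ A" "y \<in> univ A"
  shows "x \<rhd> y \<rhd> y = x \<rhd> y"
  using assms by (metis join_idem proj_join)

text \<open>As a right argument, \<open>y \<sqinter> (y \<squnion> z)\<close> acts like
  \<open>y\<close>, \<open>y\<close> and \<open>z\<close> in turn, and the repeated \<open>y\<close>
  collapses.\<close>

lemma proj_assoc:
  assumes "x \<in> univ A" "y \<in> univ A" "z \<in> univ A"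
  shows "x \<rhd> (y \<rhd> z) = x \<rhd> y \<rhd> z"
  using assms by (simp add: proj_def[of y] proj_meet proj_join)

text \<open>The order of the index semilattice of the Plonka decomposition, pulled back to the algebra.\<close>

definition below :: "'a \<Rightarrow> 'a \<Rightarrow> bool" (infix "\<preceq>" 50) where
  "x \<preceq> y \<longleftrightarrow> y \<rhd> x = y"

lemma below_refl [simp]: "x \<in> univ A \<Longrightarrow> x \<preceq> x"
  by (simp add: below_def)

lemma below_trans:
  assumes "x \<in> univ A" "y \<in> univ A" "z \<in> univ A" "x \<preceq> y" "y \<preceq> z"
  shows "x \<preceq> z"
  using assms by (metis below_def proj_assoc)

text \<open>Indices will be classes of mutually \<open>\<preceq>\<close>-related elements. With
  \<open>meet_below_iff\<close>, this makes join and meet induce the same semilattice operation on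
  them, the least upper bound.\<close>

lemma join_below_iff:
  assumes "x \<in> univ A" "y \<in> univ A" "z \<in> univ A"
  shows "x \<squnion> y \<preceq> z \<longleftrightarrow> x \<preceq> z \<and> y \<preceq> z"
  using assms unfolding below_def by (metis proj_join proj_right_comm proj_proj proj_closed)

lemma meet_below_iff:
  assumes "x \<in> univ A" "y \<in> univ A" "z \<in> univ A"
  shows "x \<sqinter> y \<preceq> z \<longleftrightarrow> x \<preceq> z \<and> y \<preceq> z"
  using join_below_iff[OF assms] assms by (simp add: below_def proj_join proj_meet)

text \<open>Right arguments commute, so the left side is \<open>x \<rhd> (z \<rhd> y)\<close>, and
  \<open>z \<rhd> y = z\<close>. This becomes the composition law for transition maps.\<close>

lemma proj_absorb:
  assumes "x \<in> univ A" "y \<in> univ A" "z \<in> univ A" "y \<preceq> z"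
  shows "x \<rhd> y \<rhd> z = x \<rhd> z"
  using assms by (metis below_def proj_assoc proj_right_comm)

end

section \<open>Prime filters\<close>

context distributive_lattice
begin

text \<open>Zorn's lemma gives a filter that contains one element and is maximal among those
  omitting the other; distributivity makes it prime, and \<open>h\<close> is membership in
  it.\<close>

lemma separating_character:
  assumes ab: "a \<in> univ A" "b \<in> univ A" "a \<noteq> b"
  obtains h :: "'a \<Rightarrow> bool" where "h a \<noteq> h b"
    "\<And>x y. \<lbrakk>x \<in> univ A; y \<in> univ A\<rbrakk> \<Longrightarrow> h (x \<sqinter> y) \<longleftrightarrow> h x \<and> h y"
    "\<And>x y. \<lbrakk>x \<in> univ A; y \<in> univ A\<rbrakk> \<Longrightarrow> h (x \<squnion> y) \<longleftrightarrow> h x \<or> h y"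
proof -
  have *: "\<exists>h. h a \<noteq> h b \<and>
      (\<forall>x\<in>univ A. \<forall>y\<in>univ A. h (x \<sqinter> y) \<longleftrightarrow> h x \<and> h y) \<and>
      (\<forall>x\<in>univ A. \<forall>y\<in>univ A. h (x \<squnion> y) \<longleftrightarrow> h x \<or> h y)"
    if [simp]: "a \<in> univ A" "b \<in> univ A" and nle: "a \<sqinter> b \<noteq> a" for a b
  proof -
    define filt where "filt F \<longleftrightarrow> F \<subseteq> univ A \<and>
      (\<forall>x\<in>F. \<forall>y\<in>F. x \<sqinter> y \<in> F) \<and> (\<forall>x\<in>F. \<forall>y\<in>univ A. x \<sqinter> y = x \<longrightarrow> y \<in> F)" for F
    define \<F> where "\<F> = {F. filt F \<and> a \<in> F \<and> b \<notin> F}"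
    \<comment> \<open>The principal filter of \<open>a\<close> omits \<open>b\<close> because
      \<open>a\<close> is not below \<open>b\<close>, so \<open>\<F>\<close> is nonempty.\<close>
    have "filt {x \<in> univ A. a \<sqinter> x = a}"
      unfolding filt_def
    proof (intro conjI ballI impI)
      fix x y assume "x \<in> {x \<in> univ A. a \<sqinter> x = a}" "y \<in> {x \<in> univ A. a \<sqinter> x = a}"
      then show "x \<sqinter> y \<in> {x \<in> univ A. a \<sqinter> x = a}"
        by (simp add: meet_assoc[symmetric])
    next
      fix x y assume "x \<in> {x \<in> univ A. a \<sqinter> x = a}" "y \<in> univ A" "x \<sqinter> y = x"
      then show "y \<in> {x \<in> univ A. a \<sqinter> x = a}"
        using meet_assoc[of a x y] by simp
    qed auto
    then have "{x \<in> univ A. a \<sqinter> x = a} \<in> \<F>"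
      unfolding \<F>_def using nle by simp
    then have ne: "\<F> \<noteq> {}" by blast
    have "\<Union>C \<in> \<F>" if "C \<noteq> {}" "subset.chain \<F> C" for C
    proof -
      have C: "\<And>F. F \<in> C \<Longrightarrow> F \<in> \<F>" "\<And>F G. F \<in> C \<Longrightarrow> G \<in> C \<Longrightarrow> F \<subseteq> G \<or> G \<subseteq> F"
        using that(2) by (auto simp: subset.chain_def)
      have "filt (\<Union>C)"
        unfolding filt_def
      proof (intro conjI ballI impI)
        show "\<Union>C \<subseteq> univ A" using C(1) unfolding \<F>_def filt_def by fast
      next
        fix x y assume "x \<in> \<Union>C" "y \<in> \<Union>C"
        then obtain H where "H \<in> C" "x \<in> H" "y \<in> H" using C(2) by blast
        then show "x \<sqinter> y \<in> \<Union>C" using C(1)[of H] by (auto simp: \<F>_def filt_def)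
      next
        fix x y assume "x \<in> \<Union>C" "y \<in> univ A" "x \<sqinter> y = x"
        then obtain H where H: "H \<in> C" "x \<in> H" by blast
        then have "y \<in> H"
          using C(1)[of H] \<open>y \<in> univ A\<close> \<open>x \<sqinter> y = x\<close> by (simp add: \<F>_def filt_def)
        with H show "y \<in> \<Union>C" by blast
      qed
      moreover have "a \<in> \<Union>C" "b \<notin> \<Union>C"
        using that(1) C(1) by (auto simp: \<F>_def)
      ultimately show ?thesis by (simp add: \<F>_def)
    qed
    from subset_Zorn_nonempty[OF ne this]
    obtain M where M: "M \<in> \<F>" and max: "\<And>F. F \<in> \<F> \<Longrightarrow> M \<subseteq> F \<Longrightarrow> F = M" by metis
    have MA: "\<And>x. x \<in> M \<Longrightarrow> x \<in> univ A" and Mm: "\<And>x y. x \<in> M \<Longrightarrow> y \<in> M \<Longrightarrow> x \<sqinter> y \<in> M"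
      and Mu: "\<And>x y. x \<in> M \<Longrightarrow> y \<in> univ A \<Longrightarrow> x \<sqinter> y = x \<Longrightarrow> y \<in> M" and aM: "a \<in> M" and bM: "b \<notin> M"
      using M unfolding \<F>_def filt_def by auto
    have ext: "\<exists>m\<in>M. m \<sqinter> x \<sqinter> b = m \<sqinter> x" if x [simp]: "x \<in> univ A" and nx: "x \<notin> M" for x
    proof (rule ccontr)
      assume nb: "\<not> ?thesis"
      \<comment> \<open>The filter generated by \<open>M\<close> and \<open>x\<close>. Since it
        properly extends \<open>M\<close>, maximality forces \<open>b\<close> into it.\<close>
      define F where "F = {z \<in> univ A. \<exists>m\<in>M. m \<sqinter> x \<sqinter> z = m \<sqinter> x}"
      have MF: "M \<subseteq> F"
      proof
        fix z assume z: "z \<in> M"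
        then have "z \<sqinter> x \<sqinter> z = z \<sqinter> x" using MA by (simp add: meet_ac)
        with z MA show "z \<in> F" unfolding F_def by blast
      qed
      have xF: "x \<in> F"
        unfolding F_def using aM by (auto intro!: bexI[of _ a] simp: meet_assoc)
      have "filt F"
        unfolding filt_def
      proof (intro conjI ballI impI)
        show "F \<subseteq> univ A" by (auto simp: F_def)
      next
        fix y z assume "y \<in> F" "z \<in> F"
        then obtain m n where mn: "m \<in> M" "n \<in> M" "m \<sqinter> x \<sqinter> y = m \<sqinter> x" "n \<sqinter> x \<sqinter> z = n \<sqinter> x"
          and [simp]: "y \<in> univ A" "z \<in> univ A" by (auto simp: F_def)
        have [simp]: "m \<in> univ A" "n \<in> univ A" using mn MA by auto
        have "m \<sqinter> n \<sqinter> x \<sqinter> (y \<sqinter> z) = (m \<sqinter> x \<sqinter> y) \<sqinter> (n \<sqinter> x \<sqinter> z)"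
          by (simp add: meet_ac)
        also have "\<dots> = m \<sqinter> n \<sqinter> x"
          unfolding mn by (simp add: meet_ac)
        finally show "y \<sqinter> z \<in> F"
          unfolding F_def using Mm[OF mn(1,2)] by auto
      next
        fix y z assume "y \<in> F" and [simp]: "z \<in> univ A" and yz: "y \<sqinter> z = y"
        then obtain m where m: "m \<in> M" "m \<sqinter> x \<sqinter> y = m \<sqinter> x" and [simp]: "y \<in> univ A"
          by (auto simp: F_def)
        have "m \<in> univ A" using m MA by auto
        then have "m \<sqinter> x \<sqinter> z = m \<sqinter> x"
          by (metis m(2) yz closed(1) meet_assoc x \<open>y \<in> univ A\<close> \<open>z \<in> univ A\<close>)
        with m(1) show "z \<in> F" unfolding F_def by auto
      qed
      moreover have "a \<in> F" "b \<notin> F"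
        using MF aM nb by (auto simp: F_def)
      ultimately have "F = M" using max[of F] MF by (simp add: \<F>_def)
      with xF nx show False by simp
    qed
    \<comment> \<open>If neither element is in \<open>M\<close>, then \<open>b\<close> lies above
      some \<open>m \<sqinter> x\<close> and some \<open>n \<sqinter> y\<close>, hence by
      distributivity above \<open>m \<sqinter> n \<sqinter> (x \<squnion> y)\<close>, which is in
      \<open>M\<close>.\<close>
    have prime: "x \<in> M \<or> y \<in> M" if [simp]: "x \<in> univ A" "y \<in> univ A" and xy: "x \<squnion> y \<in> M" for x y
    proof (rule ccontr)
      assume "\<not> ?thesis"
      then obtain m n where mn: "m \<in> M" "n \<in> M" "m \<sqinter> x \<sqinter> b = m \<sqinter> x" "n \<sqinter> y \<sqinter> b = n \<sqinter> y"
        using ext[of x] ext[of y] by auto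
      have [simp]: "m \<in> univ A" "n \<in> univ A" using mn MA by auto
      have "m \<sqinter> n \<sqinter> (x \<squnion> y) = (n \<sqinter> (m \<sqinter> x)) \<squnion> (m \<sqinter> (n \<sqinter> y))"
        by (simp add: meet_join_distrib meet_ac)
      also have "\<dots> = (n \<sqinter> (m \<sqinter> x \<sqinter> b)) \<squnion> (m \<sqinter> (n \<sqinter> y \<sqinter> b))"
        unfolding mn ..
      also have "\<dots> = m \<sqinter> n \<sqinter> (x \<squnion> y) \<sqinter> b"
        by (simp add: meet_join_distrib meet_join_distrib2 meet_ac)
      finally have "m \<sqinter> n \<sqinter> (x \<squnion> y) \<sqinter> b = m \<sqinter> n \<sqinter> (x \<squnion> y)" ..
      then have "b \<in> M"
        using Mu[of "m \<sqinter> n \<sqinter> (x \<squnion> y)" b] Mm mn xy by auto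
      with bM show False ..
    qed
    have "x \<sqinter> y \<in> M \<longleftrightarrow> x \<in> M \<and> y \<in> M" if "x \<in> univ A" "y \<in> univ A" for x y
    proof
      assume xy: "x \<sqinter> y \<in> M"
      show "x \<in> M \<and> y \<in> M"
        using Mu[OF xy, of x] Mu[OF xy, of y] that by (simp add: meet_ac)
    qed (simp add: Mm)
    moreover have "x \<squnion> y \<in> M \<longleftrightarrow> x \<in> M \<or> y \<in> M" if "x \<in> univ A" "y \<in> univ A" for x y
      using prime[OF that] Mu[of x "x \<squnion> y"] Mu[of y "x \<squnion> y"] that
        meet_join_absorb[of x y] meet_join_absorb[of y x] join_comm[of x y] by auto
    ultimately show ?thesis
      using aM bM by (intro exI[of _ "\<lambda>x. x \<in> M"]) simp
  qed
  \<comment> \<open>If each element were below the other, both would equal their meet.\<close>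
  have "a \<sqinter> b \<noteq> a \<or> b \<sqinter> a \<noteq> b"
    using ab meet_comm[of a b] by auto
  then obtain h where "h a \<noteq> h b \<and>
      (\<forall>x\<in>univ A. \<forall>y\<in>univ A. h (x \<sqinter> y) \<longleftrightarrow> h x \<and> h y) \<and>
      (\<forall>x\<in>univ A. \<forall>y\<in>univ A. h (x \<squnion> y) \<longleftrightarrow> h x \<or> h y)"
  proof
    assume "a \<sqinter> b \<noteq> a"
    then show thesis using *[of a b] ab that by blast
  next
    assume "b \<sqinter> a \<noteq> b"
    from *[OF ab(2,1) this] obtain h where "h b \<noteq> h a \<and>
      (\<forall>x\<in>univ A. \<forall>y\<in>univ A. h (x \<sqinter> y) \<longleftrightarrow> h x \<and> h y) \<and>
      (\<forall>x\<in>univ A. \<forall>y\<in>univ A. h (x \<squnion> y) \<longleftrightarrow> h x \<or> h y)" ..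
    then show thesis using that[of h] by simp
  qed
  with that[of h] show thesis by simp
qed

end

section \<open>Identities and varieties\<close>

lemma (in algebra221) eval_closed:
  assumes "range v \<subseteq> univ A"
  shows "eval A v t \<in> univ A"
  using assms by (induction t) (auto simp: meet_closed join_closed neg_closed)

text \<open>The theory of \<open>K\<close> is itself a set of identities that \<open>K\<close>
  satisfies, and it includes every other such set, so its models are the least candidate.\<close>

lemma generated_variety_eq:
  assumes "\<And>B. B \<in> K \<Longrightarrow> algebra221 B"
  shows "generated_variety K = models {e. \<forall>B\<in>K. satisfies B e}"
proof
  have "K \<subseteq> models {e. \<forall>B\<in>K. satisfies B e}"
    using assms by (auto simp: models_def)
  then show "generated_variety K \<subseteq> models {e. \<forall>B\<in>K. satisfies B e}"
    unfolding generated_variety_def by blast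
  show "models {e. \<forall>B\<in>K. satisfies B e} \<subseteq> generated_variety K"
    unfolding generated_variety_def models_def by auto
qed

lemma isomorphic_models:
  fixes A :: "'a alg" and B :: "'b alg"
  assumes iso: "isomorphic A B" and A: "A \<in> models E"
  shows "B \<in> models E"
proof -
  obtain h where bij: "bij_betw h (univ A) (univ B)"
    and hm: "\<And>x y. \<lbrakk>x \<in> univ A; y \<in> univ A\<rbrakk> \<Longrightarrow> h (x \<sqinter>\<^bsub>A\<^esub> y) = h x \<sqinter>\<^bsub>B\<^esub> h y"
    and hj: "\<And>x y. \<lbrakk>x \<in> univ A; y \<in> univ A\<rbrakk> \<Longrightarrow> h (x \<squnion>\<^bsub>A\<^esub> y) = h x \<squnion>\<^bsub>B\<^esub> h y"
    and hn: "\<And>x. x \<in> univ A \<Longrightarrow> h (\<sim>\<^bsub>A\<^esub> x) = \<sim>\<^bsub>B\<^esub> (h x)"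
    using iso unfolding isomorphic_def by blast
  interpret A: algebra221 A using A by (simp add: models_def)
  have surj: "\<exists>a\<in>univ A. h a = x" if "x \<in> univ B" for x
    using bij_betw_imp_surj_on[OF bij] that by (metis imageE)
  have img: "h x \<in> univ B" if "x \<in> univ A" for x
    using bij that by (auto simp: bij_betw_def)
  have "algebra221 B"
  proof unfold_locales
    show "univ B \<noteq> {}" using img A.univ_nonempty by auto
  next
    fix x y assume "x \<in> univ B" "y \<in> univ B"
    then show "x \<sqinter>\<^bsub>B\<^esub> y \<in> univ B" "x \<squnion>\<^bsub>B\<^esub> y \<in> univ B"
      using surj img A.meet_closed A.join_closed by (metis hm, metis hj)
  next
    fix x assume "x \<in> univ B"
    then show "\<sim>\<^bsub>B\<^esub> x \<in> univ B"
      using surj img A.neg_closed by (metis hn)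
  qed
  moreover have "satisfies B e" if "satisfies A e" for e
    unfolding satisfies_def
  proof (intro allI impI)
    fix v :: "nat \<Rightarrow> 'b" assume v: "range v \<subseteq> univ B"
    \<comment> \<open>The valuation \<open>v\<close> pulled back along the isomorphism.\<close>
    define w where "w = inv_into (univ A) h \<circ> v"
    have w: "range w \<subseteq> univ A" "h (w n) = v n" for n
      using v bij by (auto simp: w_def bij_betw_def inv_into_into f_inv_into_f image_subset_iff)
    have "h (eval A w t) = eval B v t" for t
      by (induction t) (simp_all add: hm hj hn w A.eval_closed)
    then show "eval B v (fst e) = eval B v (snd e)"
      using that w(1) unfolding satisfies_def by metis
  qed
  ultimately show ?thesis using A by (simp add: models_def)
qed

section \<open>Identities of involutive semilattices\<close>

context involutive_semilattice
begin

lemma join_le_iff: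
  assumes "x \<in> univ I" "y \<in> univ I" "c \<in> univ I"
  shows "x \<squnion> y \<squnion> c = c \<longleftrightarrow> x \<squnion> c = c \<and> y \<squnion> c = c"
proof -
  have idem: "\<And>x. x \<in> univ I \<Longrightarrow> x \<squnion> x = x"
    and comm: "\<And>x y. x \<in> univ I \<Longrightarrow> y \<in> univ I \<Longrightarrow> x \<squnion> y = y \<squnion> x"
    and assoc: "\<And>x y z. x \<in> univ I \<Longrightarrow> y \<in> univ I \<Longrightarrow> z \<in> univ I \<Longrightarrow>
      x \<squnion> y \<squnion> z = x \<squnion> (y \<squnion> z)"
    using join_semilattice unfolding semilattice_on_def by blast+
  have "x \<squnion> (x \<squnion> (y \<squnion> c)) = x \<squnion> (y \<squnion> c)" "y \<squnion> (x \<squnion> (y \<squnion> c)) = x \<squnion> (y \<squnion> c)"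
    using assms idem comm assoc join_closed by metis+
  then show ?thesis using assms by (metis assoc)
qed

lemma join_comm: "\<lbrakk>x \<in> univ I; y \<in> univ I\<rbrakk> \<Longrightarrow> x \<squnion> y = y \<squnion> x"
  using join_semilattice unfolding semilattice_on_def by blast

lemma join_idem: "x \<in> univ I \<Longrightarrow> x \<squnion> x = x"
  using join_semilattice unfolding semilattice_on_def by blast

text \<open>
  In an involutive semilattice a term denotes the join of its positive variables and of the
  negations of its negative ones; stated through upper bounds.
\<close>

lemma eval_le_iff:
  assumes v: "range v \<subseteq> univ I" and c: "c \<in> univ I"
  shows "eval I v t \<squnion> c = c \<longleftrightarrow>
      (\<forall>x\<in>Var_pos t. v x \<squnion> c = c) \<and> (\<forall>x\<in>Var_neg t. \<sim> (v x) \<squnion> c = c)"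
    and "\<sim> (eval I v t) \<squnion> c = c \<longleftrightarrow>
      (\<forall>x\<in>Var_neg t. v x \<squnion> c = c) \<and> (\<forall>x\<in>Var_pos t. \<sim> (v x) \<squnion> c = c)"
proof (induction t)
  case (Var n)
  { case 1 show ?case by simp }
  { case 2 show ?case by simp }
next
  case (Meet s t)
  { case 1 show ?case
      using v c Meet
      by (simp add: meet_eq_join join_le_iff eval_closed ball_Un conj_ac) }
  { case 2 show ?case
      using v c Meet
      by (simp add: meet_eq_join neg_join join_le_iff eval_closed neg_closed ball_Un conj_ac) }
next
  case (Join s t)
  { case 1 show ?case
      using v c Join by (simp add: join_le_iff eval_closed ball_Un conj_ac) }
  { case 2 show ?case
      using v c Join by (simp add: neg_join join_le_iff eval_closed neg_closed ball_Un conj_ac) }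
next
  case (Neg t)
  { case 1 show ?case using Neg by auto }
  { case 2 show ?case using v Neg by (auto simp: neg_neg eval_closed) }
qed

text \<open>By \<open>top\<close>, every \<open>x \<squnion> \<sim> x\<close> is the greatest
  element. A side with a variable of both signs lies above such an element and so equals it, while
  two balanced sides have the same upper bounds.\<close>

lemma satisfies_bipolarly_balanced:
  assumes top: "\<And>x y. \<lbrakk>x \<in> univ I; y \<in> univ I\<rbrakk> \<Longrightarrow> x \<squnion> \<sim> x \<squnion> y = x \<squnion> \<sim> x"
    and e: "bipolarly_balanced e"
  shows "satisfies I e"
  unfolding satisfies_def
proof (intro allI impI)
  fix v :: "nat \<Rightarrow> 'a" assume v: "range v \<subseteq> univ I"
  let ?s = "eval I v (fst e)" and ?t = "eval I v (snd e)"
  have st: "?s \<in> univ I" "?t \<in> univ I" using v by (simp_all add: eval_closed)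
  have above: "y \<squnion> eval I v u = eval I v u"
    if "x \<in> Var_pos u" "x \<in> Var_neg u" "y \<in> univ I" for x y u
  proof -
    have "v x \<in> univ I" using v by auto
    then have mem: "v x \<in> univ I" "\<sim> (v x) \<in> univ I" "eval I v u \<in> univ I"
      using v by (simp_all add: eval_closed neg_closed)
    have "v x \<squnion> \<sim> (v x) \<squnion> eval I v u = eval I v u"
      using that v mem eval_le_iff(1)[OF v mem(3), of u] join_idem by (simp add: join_le_iff)
    then have "eval I v u = v x \<squnion> \<sim> (v x)" using top[OF mem(1,3)] by simp
    then show ?thesis using top[OF mem(1) that(3)] mem that(3) join_comm join_closed by metis
  qed
  from e have "?s \<squnion> ?t = ?t \<and> ?t \<squnion> ?s = ?s"
    unfolding bipolarly_balanced_def
  proof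
    assume "bipolar e"
    then show ?thesis using above st unfolding bipolar_def by blast
  next
    assume e: "balanced_regular e"
    have "?s \<squnion> c = c \<longleftrightarrow> ?t \<squnion> c = c" if "c \<in> univ I" for c
      using e by (simp add: eval_le_iff[OF v that] balanced_regular_def)
    then show ?thesis using st join_idem by blast
  qed
  then show "?s = ?t" using join_comm st by metis
qed

end

section \<open>The equational theory of \<open>IS3\<close>\<close>

lemma involutive_semilattice_IS3: "involutive_semilattice IS3"
  by unfold_locales (auto simp: IS3_def semilattice_on_def)

lemma satisfies_IS3_subset:
  assumes sat: "satisfies IS3 e" and nb: "Var_pos (fst e) \<inter> Var_neg (fst e) = {}"
  shows "Var_pos (snd e) \<subseteq> Var_pos (fst e)" "Var_neg (snd e) \<subseteq> Var_neg (fst e)"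
proof -
  interpret involutive_semilattice IS3 by (rule involutive_semilattice_IS3)
  \<comment> \<open>All signed variables of the left side receive the value \<open>II\<close>; this
    is consistent by \<open>nb\<close>. The default \<open>JJ\<close> is not below \<open>II\<close>
    under either sign, so a signed variable occurring only on the right would be detected.\<close>
  define v where "v x =
    (if x \<in> Var_pos (fst e) then II else if x \<in> Var_neg (fst e) then NI else JJ)" for x
  have v: "range v \<subseteq> univ IS3" by (auto simp: v_def IS3_def)
  have II: "II \<in> univ IS3" by (simp add: IS3_def)
  have "eval IS3 v (fst e) \<squnion>\<^bsub>IS3\<^esub> II = II"
    unfolding eval_le_iff[OF v II] using nb by (auto simp: v_def IS3_def)
  then have "eval IS3 v (snd e) \<squnion>\<^bsub>IS3\<^esub> II = II"
    using sat v by (auto simp: satisfies_def)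
  then have *: "(\<forall>x\<in>Var_pos (snd e). v x \<squnion>\<^bsub>IS3\<^esub> II = II) \<and>
      (\<forall>x\<in>Var_neg (snd e). \<sim>\<^bsub>IS3\<^esub> (v x) \<squnion>\<^bsub>IS3\<^esub> II = II)"
    unfolding eval_le_iff[OF v II] .
  from * show "Var_pos (snd e) \<subseteq> Var_pos (fst e)"
    by (auto simp: v_def IS3_def split: if_splits)
  from * show "Var_neg (snd e) \<subseteq> Var_neg (fst e)"
    by (auto simp: v_def IS3_def split: if_splits)
qed

text \<open>If the identity is not bipolar, one side has no variable of both signs. The inclusions
  obtained from that side pass this property to the other one, which then yields the reverse
  inclusions.\<close>

lemma satisfies_IS3_iff: "satisfies IS3 e \<longleftrightarrow> bipolarly_balanced e"
proof
  assume sat: "satisfies IS3 e"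
  have sat': "satisfies IS3 (snd e, fst e)" using sat by (auto simp: satisfies_def)
  show "bipolarly_balanced e"
  proof (cases "bipolar e")
    case False
    let ?s = "fst e" and ?t = "snd e"
    have "Var_pos ?t \<subseteq> Var_pos ?s \<and> Var_neg ?t \<subseteq> Var_neg ?s"
      if "Var_pos ?s \<inter> Var_neg ?s = {}"
      using satisfies_IS3_subset[OF sat that] by simp
    moreover have "Var_pos ?s \<subseteq> Var_pos ?t \<and> Var_neg ?s \<subseteq> Var_neg ?t"
      if "Var_pos ?t \<inter> Var_neg ?t = {}"
      using satisfies_IS3_subset[OF sat'] that by simp
    moreover have "Var_pos ?s \<inter> Var_neg ?s = {} \<or> Var_pos ?t \<inter> Var_neg ?t = {}"
      using False by (simp add: bipolar_def)
    moreover have "Var_pos ?t \<inter> Var_neg ?t = {}"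
      if "Var_pos ?t \<subseteq> Var_pos ?s \<and> Var_neg ?t \<subseteq> Var_neg ?s" "Var_pos ?s \<inter> Var_neg ?s = {}"
      using that by blast
    moreover have "Var_pos ?s \<inter> Var_neg ?s = {}"
      if "Var_pos ?s \<subseteq> Var_pos ?t \<and> Var_neg ?s \<subseteq> Var_neg ?t" "Var_pos ?t \<inter> Var_neg ?t = {}"
      using that by blast
    ultimately have "Var_pos ?s = Var_pos ?t \<and> Var_neg ?s = Var_neg ?t"
      by (meson subset_antisym)
    then have "balanced_regular e"
      unfolding balanced_regular_def by auto
    then show ?thesis by (simp add: bipolarly_balanced_def)
  qed (simp add: bipolarly_balanced_def)
next
  assume "bipolarly_balanced e"
  then show "satisfies IS3 e"
    by (rule involutive_semilattice.satisfies_bipolarly_balanced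
        [OF involutive_semilattice_IS3, rotated]) (auto simp: IS3_def)
qed

section \<open>The algebra \<open>DM4\<close>\<close>

text \<open>\<open>in_pos\<close> and \<open>in_neg\<close> are membership in the two prime filters
  of \<open>DM4\<close>, that is, its coordinates in the square of the two-element lattice. The
  fixed points \<open>Tp\<close> and \<open>Bt\<close> are the two mixed pairs.\<close>

definition in_pos :: "val \<Rightarrow> bool" where "in_pos a \<longleftrightarrow> a \<in> {Tr, Tp}"
definition in_neg :: "val \<Rightarrow> bool" where "in_neg a \<longleftrightarrow> a \<in> {Tr, Bt}"

lemma DM4_embedding:
  assumes "a \<in> univ DM4" "b \<in> univ DM4"
  shows "a \<sqinter>\<^bsub>DM4\<^esub> b \<in> univ DM4" "a \<squnion>\<^bsub>DM4\<^esub> b \<in> univ DM4"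
    "in_pos (a \<sqinter>\<^bsub>DM4\<^esub> b) \<longleftrightarrow> in_pos a \<and> in_pos b"
    "in_pos (a \<squnion>\<^bsub>DM4\<^esub> b) \<longleftrightarrow> in_pos a \<or> in_pos b"
    "in_neg (a \<sqinter>\<^bsub>DM4\<^esub> b) \<longleftrightarrow> in_neg a \<and> in_neg b"
    "in_neg (a \<squnion>\<^bsub>DM4\<^esub> b) \<longleftrightarrow> in_neg a \<or> in_neg b"
    "a = b \<longleftrightarrow> (in_pos a \<longleftrightarrow> in_pos b) \<and> (in_neg a \<longleftrightarrow> in_neg b)"
  using assms by (auto simp: DM4_def in_pos_def in_neg_def)

lemma DM4_embedding_neg:
  assumes "a \<in> univ DM4"
  shows "\<sim>\<^bsub>DM4\<^esub> a \<in> univ DM4"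
    "in_pos (\<sim>\<^bsub>DM4\<^esub> a) \<longleftrightarrow> \<not> in_neg a"
    "in_neg (\<sim>\<^bsub>DM4\<^esub> a) \<longleftrightarrow> \<not> in_pos a"
  using assms by (auto simp: DM4_def in_pos_def in_neg_def)

lemma algebra221_DM4: "algebra221 DM4"
  by unfold_locales (auto simp: DM4_def)

lemma DM4_surj: "\<exists>a\<in>univ DM4. (in_pos a \<longleftrightarrow> P) \<and> (in_neg a \<longleftrightarrow> Q)"
  by (cases P; cases Q) (simp_all add: DM4_def in_pos_def in_neg_def)

section \<open>Identities in De Morgan--Plonka sums\<close>

context direct_system
begin

sublocale I: involutive_semilattice "index S"
  by (rule index)

lemma index_le_iff:
  "\<lbrakk>i \<in> univ (index S); j \<in> univ (index S)\<rbrakk> \<Longrightarrow> index_le S i j \<longleftrightarrow> i \<squnion>\<^bsub>index S\<^esub> j = j"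
  by (simp add: index_le_def)

lemma index_le_join:
  assumes "i \<in> univ (index S)" "j \<in> univ (index S)"
  shows "index_le S i (i \<squnion>\<^bsub>index S\<^esub> j)" "index_le S j (i \<squnion>\<^bsub>index S\<^esub> j)"
  using I.join_le_iff[of i j "i \<squnion>\<^bsub>index S\<^esub> j"] assms I.join_idem
  by (auto simp: index_le_def I.join_closed)

lemma index_of_eq:
  assumes "i \<in> univ (index S)" "a \<in> univ (fibre S i)"
  shows "index_of S a = i"
  unfolding index_of_def
proof (rule the_equality)
  fix j assume "j \<in> univ (index S) \<and> a \<in> univ (fibre S j)"
  then show "j = i" using assms disjoint unfolding disjoint_family_on_def by blast
qed (use assms in simp)

lemma index_of_mem:
  assumes "a \<in> univ (DP_sum S)"
  shows "index_of S a \<in> univ (index S)" "a \<in> univ (fibre S (index_of S a))"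
  using assms index_of_eq by (auto simp: DP_sum_def)

lemma mem_DP_sum:
  "\<lbrakk>i \<in> univ (index S); a \<in> univ (fibre S i)\<rbrakk> \<Longrightarrow> a \<in> univ (DP_sum S)"
  by (auto simp: DP_sum_def)

abbreviation shift where
  "shift k a \<equiv> trans_map S (index_of S a) k a"

lemma shift_mem:
  assumes "a \<in> univ (DP_sum S)" "index_le S (index_of S a) k"
  shows "shift k a \<in> univ (fibre S k)"
  using trans_hom[OF assms(2)] index_of_mem[OF assms(1)] by (auto simp: lattice_hom_def)

lemma meet_DP_sum:
  assumes a: "a \<in> univ (DP_sum S)" and b: "b \<in> univ (DP_sum S)"
  defines "k \<equiv> index_of S a \<squnion>\<^bsub>index S\<^esub> index_of S b"
  shows "a \<sqinter>\<^bsub>DP_sum S\<^esub> b = shift k a \<sqinter>\<^bsub>fibre S k\<^esub> shift k b"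
    and "a \<sqinter>\<^bsub>DP_sum S\<^esub> b \<in> univ (DP_sum S)"
    and "index_of S (a \<sqinter>\<^bsub>DP_sum S\<^esub> b) = k"
proof -
  show eq: "a \<sqinter>\<^bsub>DP_sum S\<^esub> b = shift k a \<sqinter>\<^bsub>fibre S k\<^esub> shift k b"
    by (simp add: DP_sum_def Let_def k_def)
  have k: "k \<in> univ (index S)" "index_le S (index_of S a) k" "index_le S (index_of S b) k"
    using index_of_mem a b index_le_join by (auto simp: k_def I.join_closed)
  interpret distributive_lattice "fibre S k" using fibre k by blast
  have "a \<sqinter>\<^bsub>DP_sum S\<^esub> b \<in> univ (fibre S k)"
    using shift_mem a b k unfolding eq by simp
  then show "a \<sqinter>\<^bsub>DP_sum S\<^esub> b \<in> univ (DP_sum S)" "index_of S (a \<sqinter>\<^bsub>DP_sum S\<^esub> b) = k"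
    using mem_DP_sum index_of_eq k by auto
qed

lemma join_DP_sum:
  assumes a: "a \<in> univ (DP_sum S)" and b: "b \<in> univ (DP_sum S)"
  defines "k \<equiv> index_of S a \<squnion>\<^bsub>index S\<^esub> index_of S b"
  shows "a \<squnion>\<^bsub>DP_sum S\<^esub> b = shift k a \<squnion>\<^bsub>fibre S k\<^esub> shift k b"
    and "a \<squnion>\<^bsub>DP_sum S\<^esub> b \<in> univ (DP_sum S)"
    and "index_of S (a \<squnion>\<^bsub>DP_sum S\<^esub> b) = k"
proof -
  show eq: "a \<squnion>\<^bsub>DP_sum S\<^esub> b = shift k a \<squnion>\<^bsub>fibre S k\<^esub> shift k b"
    by (simp add: DP_sum_def Let_def k_def)
  have k: "k \<in> univ (index S)" "index_le S (index_of S a) k" "index_le S (index_of S b) k"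
    using index_of_mem a b index_le_join by (auto simp: k_def I.join_closed)
  interpret distributive_lattice "fibre S k" using fibre k by blast
  have "a \<squnion>\<^bsub>DP_sum S\<^esub> b \<in> univ (fibre S k)"
    using shift_mem a b k unfolding eq by simp
  then show "a \<squnion>\<^bsub>DP_sum S\<^esub> b \<in> univ (DP_sum S)" "index_of S (a \<squnion>\<^bsub>DP_sum S\<^esub> b) = k"
    using mem_DP_sum index_of_eq k by auto
qed

lemma neg_DP_sum:
  assumes a: "a \<in> univ (DP_sum S)"
  shows "\<sim>\<^bsub>DP_sum S\<^esub> a = neg_map S (index_of S a) a"
    and "\<sim>\<^bsub>DP_sum S\<^esub> a \<in> univ (DP_sum S)"
    and "index_of S (\<sim>\<^bsub>DP_sum S\<^esub> a) = \<sim>\<^bsub>index S\<^esub> (index_of S a)"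
    and "\<sim>\<^bsub>DP_sum S\<^esub> (\<sim>\<^bsub>DP_sum S\<^esub> a) = a"
proof -
  show eq: "\<sim>\<^bsub>DP_sum S\<^esub> b = neg_map S (index_of S b) b" for b
    by (simp add: DP_sum_def)
  have mem: "\<sim>\<^bsub>index S\<^esub> (index_of S a) \<in> univ (index S)"
    using index_of_mem a I.neg_closed by blast
  have "neg_map S (index_of S a) a \<in> univ (fibre S (\<sim>\<^bsub>index S\<^esub> (index_of S a)))"
    using neg_bij index_of_mem a by (meson bij_betwE)
  then show "\<sim>\<^bsub>DP_sum S\<^esub> a \<in> univ (DP_sum S)"
    and ix: "index_of S (\<sim>\<^bsub>DP_sum S\<^esub> a) = \<sim>\<^bsub>index S\<^esub> (index_of S a)"
    using mem_DP_sum index_of_eq mem eq by auto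
  show "\<sim>\<^bsub>DP_sum S\<^esub> (\<sim>\<^bsub>DP_sum S\<^esub> a) = a"
    using eq[of "\<sim>\<^bsub>DP_sum S\<^esub> a"] ix eq[of a] neg_inverse index_of_mem a by simp
qed

lemma algebra221_DP_sum: "algebra221 (DP_sum S)"
proof unfold_locales
  obtain i where i: "i \<in> univ (index S)" using I.univ_nonempty by blast
  interpret distributive_lattice "fibre S i" using fibre i by blast
  show "univ (DP_sum S) \<noteq> {}" using univ_nonempty mem_DP_sum i by blast
qed (simp_all add: meet_DP_sum(2) join_DP_sum(2) neg_DP_sum(2))

text \<open>\<open>index_of S\<close> is a homomorphism to the index algebra, so it commutes with
  evaluation. Hence an identity valid in the index algebra puts its two sides into the same
  fibre.\<close>

lemma index_of_eval:
  assumes "range v \<subseteq> univ (DP_sum S)"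
  shows "index_of S (eval (DP_sum S) v t) = eval (index S) (index_of S \<circ> v) t"
proof (induction t)
  case (Meet s t)
  have "range (index_of S \<circ> v) \<subseteq> univ (index S)" using assms index_of_mem by auto
  with Meet show ?case
    using algebra221.eval_closed[OF algebra221_DP_sum assms]
    by (simp add: meet_DP_sum(3) I.meet_eq_join I.eval_closed)
qed (use algebra221.eval_closed[OF algebra221_DP_sum assms] in
  \<open>simp_all add: join_DP_sum(3) neg_DP_sum(3)\<close>)

text \<open>The meet is formed at the join \<open>?m\<close> of the two indices, which lies below
  \<open>k\<close>; the homomorphism from there to \<open>k\<close> composes with the earlier
  transitions.\<close>

lemma shift_meet:
  assumes a: "a \<in> univ (DP_sum S)" and b: "b \<in> univ (DP_sum S)"
    and "index_le S (index_of S a) k" "index_le S (index_of S b) k"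
  shows "shift k (a \<sqinter>\<^bsub>DP_sum S\<^esub> b) = shift k a \<sqinter>\<^bsub>fibre S k\<^esub> shift k b"
proof -
  let ?m = "index_of S a \<squnion>\<^bsub>index S\<^esub> index_of S b"
  have ia: "index_le S (index_of S a) ?m" "index_le S (index_of S b) ?m"
    using index_of_mem a b index_le_join by auto
  have mk: "index_le S ?m k"
    using assms by (simp add: index_le_def I.join_closed I.join_le_iff)
  show ?thesis
    unfolding meet_DP_sum(3)[OF a b] unfolding meet_DP_sum(1)[OF a b]
    using trans_hom[OF mk] shift_mem[OF a ia(1)] shift_mem[OF b ia(2)]
      trans_comp[OF ia(1) mk] trans_comp[OF ia(2) mk] index_of_mem[OF a] index_of_mem[OF b]
    by (simp add: lattice_hom_def)
qed

lemma shift_join: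
  assumes a: "a \<in> univ (DP_sum S)" and b: "b \<in> univ (DP_sum S)"
    and "index_le S (index_of S a) k" "index_le S (index_of S b) k"
  shows "shift k (a \<squnion>\<^bsub>DP_sum S\<^esub> b) = shift k a \<squnion>\<^bsub>fibre S k\<^esub> shift k b"
proof -
  let ?m = "index_of S a \<squnion>\<^bsub>index S\<^esub> index_of S b"
  have ia: "index_le S (index_of S a) ?m" "index_le S (index_of S b) ?m"
    using index_of_mem a b index_le_join by auto
  have mk: "index_le S ?m k"
    using assms by (simp add: index_le_def I.join_closed I.join_le_iff)
  show ?thesis
    unfolding join_DP_sum(3)[OF a b] unfolding join_DP_sum(1)[OF a b]
    using trans_hom[OF mk] shift_mem[OF a ia(1)] shift_mem[OF b ia(2)]
      trans_comp[OF ia(1) mk] trans_comp[OF ia(2) mk] index_of_mem[OF a] index_of_mem[OF b]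
    by (simp add: lattice_hom_def)
qed

text \<open>Both arguments are moved to the fibre of \<open>?m\<close>, where negation is a dual
  homomorphism, and \<open>neg_trans\<close> carries negation past the moves.\<close>

lemma neg_meet_DP_sum:
  assumes a: "a \<in> univ (DP_sum S)" and b: "b \<in> univ (DP_sum S)"
  shows "\<sim>\<^bsub>DP_sum S\<^esub> (a \<sqinter>\<^bsub>DP_sum S\<^esub> b) = \<sim>\<^bsub>DP_sum S\<^esub> a \<squnion>\<^bsub>DP_sum S\<^esub> \<sim>\<^bsub>DP_sum S\<^esub> b"
proof -
  let ?m = "index_of S a \<squnion>\<^bsub>index S\<^esub> index_of S b"
  have ia: "index_le S (index_of S a) ?m" "index_le S (index_of S b) ?m" "?m \<in> univ (index S)"
    using index_of_mem a b index_le_join by (auto simp: I.join_closed)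
  have "\<sim>\<^bsub>DP_sum S\<^esub> (a \<sqinter>\<^bsub>DP_sum S\<^esub> b) = neg_map S ?m (shift ?m a \<sqinter>\<^bsub>fibre S ?m\<^esub> shift ?m b)"
    using a b by (simp add: neg_DP_sum(1) meet_DP_sum(2,3)) (simp add: meet_DP_sum(1))
  also have "\<dots> = neg_map S ?m (shift ?m a) \<squnion>\<^bsub>fibre S (\<sim>\<^bsub>index S\<^esub> ?m)\<^esub> neg_map S ?m (shift ?m b)"
    using neg_hom[OF ia(3)] shift_mem[OF a ia(1)] shift_mem[OF b ia(2)]
    by (simp add: lattice_hom_def dual_lat_def)
  also have "\<dots> = \<sim>\<^bsub>DP_sum S\<^esub> a \<squnion>\<^bsub>DP_sum S\<^esub> \<sim>\<^bsub>DP_sum S\<^esub> b"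
    using neg_trans[OF ia(1)] neg_trans[OF ia(2)] index_of_mem[OF a] index_of_mem[OF b]
      join_DP_sum(1)[OF neg_DP_sum(2)[OF a] neg_DP_sum(2)[OF b]]
    by (simp add: neg_DP_sum(3)[OF a] neg_DP_sum(3)[OF b] I.neg_join)
      (simp add: neg_DP_sum(1)[OF a] neg_DP_sum(1)[OF b])
  finally show ?thesis .
qed

lemma neg_join_DP_sum:
  assumes a: "a \<in> univ (DP_sum S)" and b: "b \<in> univ (DP_sum S)"
  shows "\<sim>\<^bsub>DP_sum S\<^esub> (a \<squnion>\<^bsub>DP_sum S\<^esub> b) = \<sim>\<^bsub>DP_sum S\<^esub> a \<sqinter>\<^bsub>DP_sum S\<^esub> \<sim>\<^bsub>DP_sum S\<^esub> b"
  using neg_meet_DP_sum[of "\<sim>\<^bsub>DP_sum S\<^esub> a" "\<sim>\<^bsub>DP_sum S\<^esub> b"] a b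
  by (metis neg_DP_sum(2,4) meet_DP_sum(2))

end

section \<open>The common axiomatisation of the four classes\<close>

definition bip_theory :: "identity set" where
  "bip_theory = {e. bipolarly_balanced e \<and> satisfies DM4 e}"

lemma mem_generated_variety_IS3:
  "I \<in> generated_variety {IS3} \<longleftrightarrow> I \<in> models {e. bipolarly_balanced e}"
proof -
  interpret involutive_semilattice IS3 by (rule involutive_semilattice_IS3)
  show ?thesis
    using algebra221_axioms by (subst generated_variety_eq) (simp_all add: satisfies_IS3_iff)
qed

lemma (in involutive_semilattice) mem_generated_variety_IS3I:
  assumes "\<And>x y. \<lbrakk>x \<in> univ I; y \<in> univ I\<rbrakk> \<Longrightarrow> x \<squnion> \<sim> x \<squnion> y = x \<squnion> \<sim> x"
  shows "I \<in> generated_variety {IS3}"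
  unfolding mem_generated_variety_IS3
  using algebra221_axioms satisfies_bipolarly_balanced[OF assms] by (simp add: models_def)

lemma (in direct_system) DP_sum_mem_models:
  assumes IS3: "index S \<in> generated_variety {IS3}"
  shows "DP_sum S \<in> models bip_theory"
proof -
  have "satisfies (DP_sum S) e" if bal: "bipolarly_balanced e" and DM4: "satisfies DM4 e" for e
    unfolding satisfies_def
  proof (intro allI impI, rule ccontr)
    fix v :: "nat \<Rightarrow> 'b" assume v: "range v \<subseteq> univ (DP_sum S)"
    let ?D = "DP_sum S" and ?n = "\<lambda>i. \<sim>\<^bsub>index S\<^esub> i"
    let ?s = "eval ?D v (fst e)" and ?t = "eval ?D v (snd e)"
    assume neq: "?s \<noteq> ?t"
    interpret D: algebra221 ?D by (rule algebra221_DP_sum)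
    have mem: "eval ?D v u \<in> univ ?D" for u using D.eval_closed v by blast
    define k where "k = index_of S ?s"
    have k: "k \<in> univ (index S)" using index_of_mem mem by (simp add: k_def)
    have "range (index_of S \<circ> v) \<subseteq> univ (index S)" using v index_of_mem by auto
    \<comment> \<open>The index algebra validates every bipolarly balanced identity, so both sides
      have index \<open>k\<close>.\<close>
    moreover have "satisfies (index S) e"
      using IS3 bal unfolding mem_generated_variety_IS3 models_def by blast
    ultimately have kt: "index_of S ?t = k"
      unfolding k_def index_of_eval[OF v] satisfies_def by simp
    interpret L: distributive_lattice "fibre S k" using fibre k by blast
    have st: "?s \<in> univ (fibre S k)" "?t \<in> univ (fibre S k)"
      using index_of_mem mem kt k_def by metis+
    obtain h where h: "h ?s \<noteq> h ?t"
      and h_meet: "\<And>x y. \<lbrakk>x \<in> univ (fibre S k); y \<in> univ (fibre S k)\<rbrakk> \<Longrightarrow>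
        h (x \<sqinter>\<^bsub>fibre S k\<^esub> y) \<longleftrightarrow> h x \<and> h y"
      and h_join: "\<And>x y. \<lbrakk>x \<in> univ (fibre S k); y \<in> univ (fibre S k)\<rbrakk> \<Longrightarrow>
        h (x \<squnion>\<^bsub>fibre S k\<^esub> y) \<longleftrightarrow> h x \<or> h y"
      by (rule L.separating_character[OF st neq]) (rule that)
    \<comment> \<open>The two intended \<open>DM4\<close> coordinates of \<open>a\<close>, one read
      off from \<open>a\<close> and one from its negation.\<close>
    let ?pos = "\<lambda>a. h (shift k a)" and ?neg = "\<lambda>a. \<not> h (shift k (\<sim>\<^bsub>?D\<^esub> a))"
    \<comment> \<open>The coordinates are meaningful only when the index of \<open>a\<close>,
      respectively of its negation, is below \<open>k\<close>; one may hold without the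
      other.\<close>
    let ?le = "\<lambda>a. index_le S (index_of S a) k" and ?le' = "\<lambda>a. index_le S (?n (index_of S a)) k"
    \<comment> \<open>A compound element can be moved to \<open>k\<close> exactly when its parts
      can, so the guards descend to subterms in the induction.\<close>
    have le_meet: "?le (a \<sqinter>\<^bsub>?D\<^esub> b) \<longleftrightarrow> ?le a \<and> ?le b" "?le (a \<squnion>\<^bsub>?D\<^esub> b) \<longleftrightarrow> ?le a \<and> ?le b"
      "?le' (a \<sqinter>\<^bsub>?D\<^esub> b) \<longleftrightarrow> ?le' a \<and> ?le' b" "?le' (a \<squnion>\<^bsub>?D\<^esub> b) \<longleftrightarrow> ?le' a \<and> ?le' b"
      "?le' a \<longleftrightarrow> ?le (\<sim>\<^bsub>?D\<^esub> a)" "?le' (\<sim>\<^bsub>?D\<^esub> a) \<longleftrightarrow> ?le a"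
      if "a \<in> univ ?D" "b \<in> univ ?D" for a b
      using that k index_of_mem(1)[OF that(1)] index_of_mem(1)[OF that(2)]
      by (simp_all add: meet_DP_sum(3) join_DP_sum(3) neg_DP_sum(3) index_le_iff I.neg_join
          I.join_closed I.neg_closed I.join_le_iff I.neg_neg)
    have pos: "?pos (a \<sqinter>\<^bsub>?D\<^esub> b) \<longleftrightarrow> ?pos a \<and> ?pos b" "?pos (a \<squnion>\<^bsub>?D\<^esub> b) \<longleftrightarrow> ?pos a \<or> ?pos b"
      if "a \<in> univ ?D" "b \<in> univ ?D" "?le a" "?le b" for a b
      using that by (simp_all add: shift_meet shift_join h_meet h_join shift_mem)
    \<comment> \<open>Negation swaps the operations and the complement in \<open>?neg\<close> swaps
      them back.\<close>
    have neg: "?neg (a \<sqinter>\<^bsub>?D\<^esub> b) \<longleftrightarrow> ?neg a \<and> ?neg b" "?neg (a \<squnion>\<^bsub>?D\<^esub> b) \<longleftrightarrow> ?neg a \<or> ?neg b"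
      if "a \<in> univ ?D" "b \<in> univ ?D" "?le' a" "?le' b" for a b
      using that pos[of "\<sim>\<^bsub>?D\<^esub> a" "\<sim>\<^bsub>?D\<^esub> b"] le_meet
      by (simp_all add: neg_meet_DP_sum neg_join_DP_sum neg_DP_sum(2))
    \<comment> \<open>Every pair of truth values occurs in \<open>DM4\<close>, so \<open>w\<close>
      can be prescribed by coordinates; where a guard fails, the prescribed coordinate is
      arbitrary.\<close>
    have "\<forall>x. \<exists>a\<in>univ DM4. (in_pos a \<longleftrightarrow> ?pos (v x)) \<and> (in_neg a \<longleftrightarrow> ?neg (v x))"
      using DM4_surj by blast
    then obtain w where w: "\<And>x. w x \<in> univ DM4"
      "\<And>x. in_pos (w x) \<longleftrightarrow> ?pos (v x)" "\<And>x. in_neg (w x) \<longleftrightarrow> ?neg (v x)"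
      by metis
    have w_mem: "eval DM4 w u \<in> univ DM4" for u
      using w(1) algebra221.eval_closed[OF algebra221_DM4] by (simp add: image_subset_iff)
    \<comment> \<open>The two guarded claims must be proved together, because the case of negation
      exchanges them.\<close>
    have val: "(?le (eval ?D v u) \<longrightarrow> (in_pos (eval DM4 w u) \<longleftrightarrow> ?pos (eval ?D v u))) \<and>
      (?le' (eval ?D v u) \<longrightarrow> (in_neg (eval DM4 w u) \<longleftrightarrow> ?neg (eval ?D v u)))" for u
    proof (induction u)
      case (Var x)
      then show ?case using w by simp
    next
      case (Meet s t)
      then show ?case
        using pos[OF mem mem, of s t] neg[OF mem mem, of s t]
        by (simp add: le_meet[OF mem mem] DM4_embedding w_mem)
    next
      case (Join s t)
      then show ?case
        using pos[OF mem mem, of s t] neg[OF mem mem, of s t]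
        by (simp add: le_meet[OF mem mem] DM4_embedding w_mem)
    next
      case (Neg t)
      then show ?case
        using le_meet(5,6)[OF mem[of t] mem[of t]]
        by (simp add: DM4_embedding_neg w_mem neg_DP_sum(4)[OF mem])
    qed
    have "?pos ?s \<longleftrightarrow> ?pos ?t"
    proof -
      have "index_le S k k" using k by (simp add: index_le_iff I.join_idem)
      moreover have "eval DM4 w (fst e) = eval DM4 w (snd e)"
        using DM4 w(1) by (simp add: satisfies_def image_subset_iff)
      ultimately show ?thesis
        using val[of "fst e"] val[of "snd e"] kt by (simp add: k_def)
    qed
    \<comment> \<open>On the fibre of \<open>k\<close> the shift is the identity, so equal positive
      coordinates contradict the choice of \<open>h\<close>.\<close>
    moreover have "shift k ?s = ?s" "shift k ?t = ?t"
      using trans_id[OF k] index_of_mem(2)[OF mem] kt by (metis k_def)+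
    ultimately show False using h by simp
  qed
  then show ?thesis using algebra221_DP_sum by (simp add: models_def bip_theory_def)
qed

lemma DP_sums_subset_models: "DP_sums TYPE('i) TYPE('b) \<subseteq> (models bip_theory :: 'a alg set)"
  unfolding DP_sums_def
  using isomorphic_models direct_system.DP_sum_mem_models by blast

text \<open>The axioms to be instantiated use at most three variables; all variables from index 2 on
  receive \<open>z\<close>.\<close>

lemma satisfies_triple:
  assumes "A \<in> models E" "(s, t) \<in> E" "x \<in> univ A" "y \<in> univ A" "z \<in> univ A"
  shows "eval A (\<lambda>n::nat. if n = 0 then x else if n = 1 then y else z) s =
    eval A (\<lambda>n. if n = 0 then x else if n = 1 then y else z) t"
proof -
  have "satisfies A (s, t)" using assms by (simp add: models_def)
  moreover have "range (\<lambda>n::nat. if n = 0 then x else if n = 1 then y else z) \<subseteq> univ A"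
    using assms by auto
  ultimately show ?thesis by (simp add: satisfies_def)
qed

text \<open>Reading both coordinates reduces validity in \<open>DM4\<close> to propositional
  reasoning.\<close>

lemma satisfies_DM4_iff:
  "satisfies DM4 (s, t) \<longleftrightarrow> (\<forall>v. (\<forall>n. v n \<in> univ DM4) \<longrightarrow>
    (in_pos (eval DM4 v s) \<longleftrightarrow> in_pos (eval DM4 v t)) \<and>
    (in_neg (eval DM4 v s) \<longleftrightarrow> in_neg (eval DM4 v t)))"
  using algebra221.eval_closed[OF algebra221_DM4]
  by (auto simp: satisfies_def image_subset_iff DM4_embedding(7))

text \<open>Each defining identity is valid in \<open>DM4\<close> and bipolarly balanced. The last
  has \<open>y\<close> on one side only, but it is bipolar since \<open>x\<close> occurs with both
  signs on each side; the others are balanced regular.\<close>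

lemma models_subset_BDMBL: "models bip_theory \<subseteq> (BDMBL :: 'a alg set)"
proof
  fix A :: "'a alg" assume A: "A \<in> models bip_theory"
  interpret algebra221 A using A by (simp add: models_def)
  let ?x = "Var 0" and ?y = "Var 1" and ?z = "Var 2"
  note bip = bip_theory_def bipolarly_balanced_def bipolar_def balanced_regular_def
    satisfies_DM4_iff DM4_embedding(1-6) DM4_embedding_neg Un_ac
  have ax: "(Meet ?x ?x, ?x) \<in> bip_theory" "(Meet ?x ?y, Meet ?y ?x) \<in> bip_theory"
    "(Meet (Meet ?x ?y) ?z, Meet ?x (Meet ?y ?z)) \<in> bip_theory"
    "(Join ?x ?x, ?x) \<in> bip_theory" "(Join ?x ?y, Join ?y ?x) \<in> bip_theory"
    "(Join (Join ?x ?y) ?z, Join ?x (Join ?y ?z)) \<in> bip_theory"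
    "(Meet ?x (Join ?y ?z), Join (Meet ?x ?y) (Meet ?x ?z)) \<in> bip_theory"
    "(Join ?x (Meet ?y ?z), Meet (Join ?x ?y) (Join ?x ?z)) \<in> bip_theory"
    "(Neg (Neg ?x), ?x) \<in> bip_theory"
    "(Neg (Meet ?x ?y), Join (Neg ?x) (Neg ?y)) \<in> bip_theory"
    "(Neg (Join ?x ?y), Meet (Neg ?x) (Neg ?y)) \<in> bip_theory"
    "(Meet ?x (Join ?x (Neg ?x)),
      Meet (Meet ?x (Join ?x (Neg ?x))) (Join (Join ?x (Neg ?x)) ?y)) \<in> bip_theory"
    by (auto simp: bip)
  note inst = ax[THEN satisfies_triple[OF A]]
  have "de_morgan_bisemilattice A"
  proof unfold_locales
    show "semilattice_on (univ A) (meet A)" "semilattice_on (univ A) (join A)"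
      unfolding semilattice_on_def using inst(1-6) by (simp_all add: numeral_2_eq_2)
  qed (use inst(7-11) in simp_all)
  then show "A \<in> BDMBL"
    using inst(12) by (simp add: BDMBL_def DMBL_def)
qed

section \<open>The Plonka decomposition\<close>

context distributive_bisemilattice
begin

lemma below_join [simp]:
  "\<lbrakk>x \<in> univ A; y \<in> univ A\<rbrakk> \<Longrightarrow> x \<preceq> x \<squnion> y" "\<lbrakk>x \<in> univ A; y \<in> univ A\<rbrakk> \<Longrightarrow> y \<preceq> x \<squnion> y"
  using join_below_iff[of x y "x \<squnion> y"] by simp_all

lemma proj_below_iff:
  "\<lbrakk>x \<in> univ A; y \<in> univ A; z \<in> univ A\<rbrakk> \<Longrightarrow> x \<rhd> y \<preceq> z \<longleftrightarrow> x \<preceq> z \<and> y \<preceq> z"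
  by (auto simp: proj_def meet_below_iff join_below_iff)

text \<open>Only the class of the right argument matters, so a transition map can be given by any
  element of the target fibre.\<close>

lemma proj_cong:
  assumes "x \<in> univ A" "y \<in> univ A" "z \<in> univ A" "y \<preceq> z" "z \<preceq> y"
  shows "x \<rhd> y = x \<rhd> z"
  using assms proj_absorb[of x y z] proj_absorb[of x z y] by (simp add: proj_right_comm)

text \<open>A chosen element of the class of \<open>x\<close> serves as its index, so that indices
  stay in the type of the algebra.\<close>

definition rep :: "'a \<Rightarrow> 'a" where
  "rep x = (SOME y. y \<in> univ A \<and> x \<preceq> y \<and> y \<preceq> x)"

lemma
  assumes "x \<in> univ A"
  shows rep_mem [simp]: "rep x \<in> univ A" and below_rep: "x \<preceq> rep x" and rep_below: "rep x \<preceq> x"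
proof -
  have "rep x \<in> univ A \<and> x \<preceq> rep x \<and> rep x \<preceq> x"
    unfolding rep_def by (rule someI[of _ x]) (simp add: assms)
  then show "rep x \<in> univ A" "x \<preceq> rep x" "rep x \<preceq> x" by auto
qed

lemma rep_below_iff [simp]: "\<lbrakk>x \<in> univ A; y \<in> univ A\<rbrakk> \<Longrightarrow> rep x \<preceq> y \<longleftrightarrow> x \<preceq> y"
  using below_trans[of x "rep x" y] below_trans[of "rep x" x y] below_rep[of x] rep_below[of x]
  by auto

lemma below_rep_iff [simp]: "\<lbrakk>x \<in> univ A; y \<in> univ A\<rbrakk> \<Longrightarrow> x \<preceq> rep y \<longleftrightarrow> x \<preceq> y"
  using below_trans[of x "rep y" y] below_trans[of x y "rep y"] below_rep[of y] rep_below[of y]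
  by auto

text \<open>Equal upper bounds mean equal classes, so \<open>SOME\<close> chooses from the same
  predicate. Index laws thereby reduce to comparing upper bounds.\<close>

lemma rep_eqI:
  assumes [simp]: "x \<in> univ A" "y \<in> univ A" and "\<And>c. c \<in> univ A \<Longrightarrow> x \<preceq> c \<longleftrightarrow> y \<preceq> c"
  shows "rep x = rep y"
proof -
  have "y \<preceq> x" "x \<preceq> y" using assms(3)[of x] assms(3)[of y] by simp_all
  then have "(c \<in> univ A \<and> x \<preceq> c \<and> c \<preceq> x) \<longleftrightarrow> (c \<in> univ A \<and> y \<preceq> c \<and> c \<preceq> y)" for c
    using assms(3)[of c] below_trans[of c x y] below_trans[of c y x] by auto
  then show ?thesis by (simp add: rep_def)
qed

lemma rep_eq_iff:
  assumes [simp]: "x \<in> univ A" "y \<in> univ A"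
  shows "rep x = rep y \<longleftrightarrow> x \<preceq> y \<and> y \<preceq> x"
proof
  assume "rep x = rep y"
  then show "x \<preceq> y \<and> y \<preceq> x"
    using below_rep_iff[of x y] below_rep_iff[of y x] below_rep[of x] below_rep[of y] by simp
next
  assume "x \<preceq> y \<and> y \<preceq> x"
  then show "rep x = rep y"
    using below_trans[of x y] below_trans[of y x] by (auto intro!: rep_eqI)
qed

lemma below_cong: "\<lbrakk>x \<in> univ A; y \<in> univ A; z \<in> univ A; rep x = rep y\<rbrakk> \<Longrightarrow> x \<preceq> z \<longleftrightarrow> y \<preceq> z"
  using rep_below_iff[of x z] rep_below_iff[of y z] by simp

lemma rep_rep [simp]: "x \<in> univ A \<Longrightarrow> rep (rep x) = rep x"
  by (rule rep_eqI) simp_all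

end

section \<open>The direct system of a De Morgan bisemilattice\<close>

context de_morgan_bisemilattice
begin

lemmas neg_simps [simp] = neg_closed neg_neg

text \<open>Negation turns the meet form of \<open>\<rhd>\<close> into its join form, and
  \<open>proj_eq_join\<close> identifies the two.\<close>

lemma neg_proj: "\<lbrakk>x \<in> univ A; y \<in> univ A\<rbrakk> \<Longrightarrow> \<sim> (x \<rhd> y) = \<sim> x \<rhd> \<sim> y"
  unfolding proj_def[of x] by (simp add: proj_eq_join neg_meet neg_join)

lemma neg_below_iff: 
  assumes "x \<in> univ A" "y \<in> univ A"
  shows "\<sim> x \<preceq> y \<longleftrightarrow> x \<preceq> \<sim> y"
  unfolding below_def using assms neg_proj[of y "\<sim> x"] neg_proj[of "\<sim> y" x] by auto

lemma neg_rep_below_iff [simp]: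
  "\<lbrakk>x \<in> univ A; y \<in> univ A\<rbrakk> \<Longrightarrow> \<sim> (rep x) \<preceq> y \<longleftrightarrow> \<sim> x \<preceq> y"
  by (simp add: neg_below_iff)

definition plonka_system :: "('a, 'a) system" where
  "plonka_system = \<lparr>
     index = \<lparr>univ = rep ` univ A, meet = (\<lambda>i j. rep (i \<squnion> j)), join = (\<lambda>i j. rep (i \<squnion> j)),
       neg = (\<lambda>i. rep (\<sim> i))\<rparr>,
     fibre = (\<lambda>i. \<lparr>univ = {x \<in> univ A. rep x = i}, meet = meet A, join = join A\<rparr>),
     trans_map = (\<lambda>i j x. x \<rhd> j),
     neg_map = (\<lambda>i x. \<sim> x)\<rparr>"

lemma plonka_system_simps [simp]:
  "univ (index plonka_system) = rep ` univ A"
  "meet (index plonka_system) i j = rep (i \<squnion> j)"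
  "join (index plonka_system) i j = rep (i \<squnion> j)"
  "neg (index plonka_system) i = rep (\<sim> i)"
  "univ (fibre plonka_system i) = {x \<in> univ A. rep x = i}"
  "meet (fibre plonka_system i) = meet A"
  "join (fibre plonka_system i) = join A"
  "trans_map plonka_system i j x = x \<rhd> j"
  "neg_map plonka_system i x = \<sim> x"
  by (simp_all add: plonka_system_def)

lemma index_le_plonka_system:
  "index_le plonka_system i j \<longleftrightarrow> i \<in> rep ` univ A \<and> j \<in> rep ` univ A \<and> i \<preceq> j"
proof -
  have "rep (rep x \<squnion> rep y) = rep y \<longleftrightarrow> rep x \<preceq> rep y" if "x \<in> univ A" "y \<in> univ A" for x y
    using that by (simp add: rep_eq_iff join_below_iff)
      (metis below_join(2) below_rep below_trans closed(2) rep_mem)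
  then show ?thesis by (auto simp: index_le_def)
qed

lemma involutive_semilattice_plonka: "involutive_semilattice (index plonka_system)"
proof unfold_locales
  show "univ (index plonka_system) \<noteq> {}" using univ_nonempty by simp
next
  show "semilattice_on (univ (index plonka_system)) (join (index plonka_system))"
    unfolding semilattice_on_def by (auto intro!: rep_eqI simp: join_below_iff)
qed (auto intro!: rep_eqI simp: join_below_iff neg_below_iff)

text \<open>Elements of one class satisfy \<open>x \<rhd> y = x\<close>, and the two forms of
  \<open>\<rhd>\<close> make this the two absorption laws. The remaining laws are inherited from the
  algebra.\<close>

lemma distributive_lattice_plonka:
  assumes "i \<in> rep ` univ A"
  shows "distributive_lattice (fibre plonka_system i)"
proof -
  obtain z where [simp]: "z \<in> univ A" and i: "i = rep z" using assms by auto
  have le: "y \<preceq> x" if "x \<in> univ A" "y \<in> univ A" "rep x = i" "rep y = i" for x y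
    using that rep_eq_iff[of x y] by simp
  show ?thesis
  proof unfold_locales
    show "univ (fibre plonka_system i) \<noteq> {}" using i by (auto intro: exI[of _ z])
  next
    fix x y assume "x \<in> univ (fibre plonka_system i)" "y \<in> univ (fibre plonka_system i)"
    then have xy: "x \<in> univ A" "y \<in> univ A" "rep x = i" "rep y = i" by auto
    with le have x: "x \<rhd> y = x" by (simp add: below_def)
    show "x \<sqinter>\<^bsub>fibre plonka_system i\<^esub> (x \<squnion>\<^bsub>fibre plonka_system i\<^esub> y) = x"
      using x by (simp add: proj_def)
    show "x \<squnion>\<^bsub>fibre plonka_system i\<^esub> (x \<sqinter>\<^bsub>fibre plonka_system i\<^esub> y) = x"
      using x xy by (simp add: proj_eq_join)
    have "y \<preceq> c \<longleftrightarrow> x \<preceq> c" if "c \<in> univ A" for c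
      using below_cong[of y x c] xy that by simp
    then have "rep (x \<sqinter> y) = rep x" "rep (x \<squnion> y) = rep x"
      using xy(1,2) by (auto intro!: rep_eqI simp: meet_below_iff join_below_iff)
    then show "x \<sqinter>\<^bsub>fibre plonka_system i\<^esub> y \<in> univ (fibre plonka_system i)"
      "x \<squnion>\<^bsub>fibre plonka_system i\<^esub> y \<in> univ (fibre plonka_system i)"
      using xy by auto
  next
    show "semilattice_on (univ (fibre plonka_system i)) (meet (fibre plonka_system i))"
      "semilattice_on (univ (fibre plonka_system i)) (join (fibre plonka_system i))"
      unfolding semilattice_on_def by (auto simp: meet_ac join_ac)
  qed (auto intro: meet_join_distrib join_meet_distrib)
qed

lemma direct_system_plonka: "direct_system plonka_system"
proof (rule direct_system.intro)
  show "involutive_semilattice (index plonka_system)" by (rule involutive_semilattice_plonka)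
next
  fix i assume "i \<in> univ (index plonka_system)"
  then show "distributive_lattice (fibre plonka_system i)"
    by (simp add: distributive_lattice_plonka)
next
  show "disjoint_family_on (\<lambda>i. univ (fibre plonka_system i)) (univ (index plonka_system))"
    by (auto simp: disjoint_family_on_def)
next
  fix i j assume "index_le plonka_system i j"
  then obtain y where y: "y \<in> univ A" "j = rep y" and ij: "i \<preceq> j"
    by (auto simp: index_le_plonka_system)
  \<comment> \<open>The upper bounds of \<open>x \<rhd> j\<close> are the common ones of
    \<open>x\<close> and \<open>j\<close>; as \<open>x \<preceq> j\<close>, these are the upper
    bounds of \<open>j\<close>.\<close>
  have "rep (x \<rhd> j) = rep j" if "x \<in> univ A" "rep x = i" for x
    using that y ij below_trans[of x j] by (auto intro!: rep_eqI simp: proj_below_iff)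
  then show "lattice_hom (fibre plonka_system i) (fibre plonka_system j)
      (trans_map plonka_system i j)"
    using y by (auto simp: lattice_hom_def meet_proj join_proj)
next
  fix i x assume "i \<in> univ (index plonka_system)" "x \<in> univ (fibre plonka_system i)"
  then show "trans_map plonka_system i i x = x"
    using rep_below[of x] by (auto simp: below_def)
next
  fix i j k x assume "index_le plonka_system i j" "index_le plonka_system j k"
    "x \<in> univ (fibre plonka_system i)"
  then show "trans_map plonka_system j k (trans_map plonka_system i j x) =
      trans_map plonka_system i k x"
    by (auto simp: index_le_plonka_system intro!: proj_absorb)
next
  fix i assume "i \<in> univ (index plonka_system)"
  then have i: "i \<in> univ A" "rep i = i" by auto
  \<comment> \<open>Facts \<open>1\<close> and \<open>2\<close> say that negation maps the class of
    \<open>i\<close> into that of \<open>\<sim> i\<close> and back, so it is its own inverse between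
    them.\<close>
  have 1: "rep (\<sim> x) = rep (\<sim> (rep x))" if "x \<in> univ A" for x
    using that by (auto intro!: rep_eqI)
  have "rep (\<sim> x) = rep i" if "x \<in> univ A" "rep x = rep (\<sim> i)" for x
    by (rule rep_eqI) (use that i(1) below_cong[of x "\<sim> i"] in \<open>simp_all add: neg_below_iff\<close>)
  then have 2: "rep (\<sim> x) = i" if "x \<in> univ A" "rep x = rep (\<sim> i)" for x
    using that i(2) by metis
  show "bij_betw (neg_map plonka_system i) (univ (fibre plonka_system i))
      (univ (fibre plonka_system (\<sim>\<^bsub>index plonka_system\<^esub> i)))"
    by (rule bij_betw_byWitness[where f' = "neg A"]) (auto intro: 1 2)
  show "lattice_hom (fibre plonka_system i)
      (dual_lat (fibre plonka_system (\<sim>\<^bsub>index plonka_system\<^esub> i))) (neg_map plonka_system i)"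
    by (auto simp: lattice_hom_def dual_lat_def neg_meet neg_join intro: 1)
next
  fix i x assume "i \<in> univ (index plonka_system)" "x \<in> univ (fibre plonka_system i)"
  then show "neg_map plonka_system (\<sim>\<^bsub>index plonka_system\<^esub> i) (neg_map plonka_system i x) = x"
    by simp
next
  fix i j x assume "index_le plonka_system i j" "x \<in> univ (fibre plonka_system i)"
  \<comment> \<open>The two sides are \<open>\<sim> x \<rhd> \<sim> j\<close> and
    \<open>\<sim> x \<rhd> rep (\<sim> j)\<close>, whose right arguments share a class.\<close>
  then show "neg_map plonka_system j (trans_map plonka_system i j x) =
      trans_map plonka_system (\<sim>\<^bsub>index plonka_system\<^esub> i) (\<sim>\<^bsub>index plonka_system\<^esub> j)
        (neg_map plonka_system i x)"
    by (auto simp: index_le_plonka_system neg_proj below_rep rep_below intro!: proj_cong)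
qed

lemma isomorphic_DP_sum_plonka: "isomorphic (DP_sum plonka_system) A"
proof -
  interpret P: direct_system plonka_system by (rule direct_system_plonka)
  have univ: "univ (DP_sum plonka_system) = univ A" by (auto simp: DP_sum_def)
  have ix: "index_of plonka_system x = rep x" if "x \<in> univ A" for x
    using that by (intro P.index_of_eq) auto
  \<comment> \<open>The operations of the sum are those of the algebra: shifting both arguments to
    \<open>k\<close> shifts the result, which already lies above \<open>k\<close> and stays fixed.
    Hence the identity map is an isomorphism.\<close>
  have "(x \<rhd> k) \<sqinter> (y \<rhd> k) = x \<sqinter> y" "(x \<rhd> k) \<squnion> (y \<rhd> k) = x \<squnion> y"
    if "x \<in> univ A" "y \<in> univ A" "k = rep (rep x \<squnion> rep y)" for x y k
  proof -
    have "k \<preceq> x \<sqinter> y" "k \<preceq> x \<squnion> y" "k \<in> univ A"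
      using that meet_below_iff[of x y "x \<sqinter> y"] by (auto simp: join_below_iff)
    then show "(x \<rhd> k) \<sqinter> (y \<rhd> k) = x \<sqinter> y" "(x \<rhd> k) \<squnion> (y \<rhd> k) = x \<squnion> y"
      using that(1,2) by (simp_all add: below_def meet_proj join_proj)
  qed
  then show ?thesis
    unfolding isomorphic_def using univ
    by (intro exI[of _ id]) (simp add: DP_sum_def Let_def ix)
qed

lemma mem_DP_sums:
  assumes bounded: "\<And>x y. \<lbrakk>x \<in> univ A; y \<in> univ A\<rbrakk> \<Longrightarrow>
    x \<sqinter> (x \<squnion> \<sim> x) = x \<sqinter> (x \<squnion> \<sim> x) \<sqinter> (x \<squnion> \<sim> x \<squnion> y)"
  shows "A \<in> DP_sums TYPE('a) TYPE('a)"
proof -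
  interpret P: direct_system plonka_system by (rule direct_system_plonka)
  \<comment> \<open>In the bounding identity \<open>y\<close> occurs only on the right. An upper
    bound of \<open>x\<close> and \<open>\<sim> x\<close> is above the left side, hence above the
    right side and above \<open>y\<close>.\<close>
  have top: "y \<preceq> c" if "x \<in> univ A" "y \<in> univ A" "c \<in> univ A" "x \<preceq> c" "\<sim> x \<preceq> c" for x y c
  proof -
    have "x \<sqinter> (x \<squnion> \<sim> x) \<preceq> c" using that by (simp add: meet_below_iff join_below_iff)
    then have "x \<sqinter> (x \<squnion> \<sim> x) \<sqinter> (x \<squnion> \<sim> x \<squnion> y) \<preceq> c" using bounded that by simp
    then show ?thesis using that by (simp add: meet_below_iff join_below_iff)
  qed
  have "index plonka_system \<in> generated_variety {IS3}"
    by (rule P.I.mem_generated_variety_IS3I)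
      (auto intro!: rep_eqI simp: join_below_iff intro: top)
  then show ?thesis
    unfolding DP_sums_def using direct_system_plonka isomorphic_DP_sum_plonka by blast
qed

end

lemma BDMBL_subset_DP_sums: "(BDMBL :: 'a alg set) \<subseteq> DP_sums TYPE('a) TYPE('a)"
proof
  fix A :: "'a alg" assume A: "A \<in> BDMBL"
  then interpret de_morgan_bisemilattice A by (simp add: BDMBL_def DMBL_def)
  show "A \<in> DP_sums TYPE('a) TYPE('a)"
    using A by (intro mem_DP_sums) (simp add: BDMBL_def)
qed

text \<open>The inclusions of \<open>BDMBL\<close> in the sums, of the sums in the models, and of
  the models in \<open>BDMBL\<close> close a cycle.\<close>

lemma BDMBL_eq_models: "(BDMBL :: 'a alg set) = models bip_theory"
  using BDMBL_subset_DP_sums DP_sums_subset_models models_subset_BDMBL by blast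

section \<open>The generated varieties\<close>

lemma DML_subset_BDMBL: "DML \<subseteq> BDMBL"
proof
  fix A :: "'a alg" assume A: "A \<in> DML"
  then interpret de_morgan_bisemilattice A by (simp add: DML_def DMBL_def)
  interpret distributive_lattice A using A by (simp add: DML_def)
  show "A \<in> BDMBL"
    using A by (simp add: DML_def BDMBL_def meet_join_absorb join_assoc)
qed

text \<open>An infinite type has finite subsets of every size, and the operations are transported
  along a bijection onto one. This places a copy of \<open>DM4\<close> in the type over which
  \<open>DML\<close> is taken.\<close>

lemma finite_isomorphic_copy:
  fixes A :: "'a alg"
  assumes "algebra221 A" "finite (univ A)"
  obtains B :: "'b::infinite alg" where "isomorphic A B" "isomorphic B A"
proof -
  interpret algebra221 A by fact
  obtain C :: "'b set" where "finite C" "card C = card (univ A)"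
    using infinite_arbitrarily_large[OF infinite_UNIV] by blast
  then obtain f where f: "bij_betw f (univ A) C"
    using finite_same_card_bij assms(2) by metis
  let ?g = "inv_into (univ A) f"
  let ?B = "\<lparr>univ = C, meet = \<lambda>x y. f (?g x \<sqinter>\<^bsub>A\<^esub> ?g y), join = \<lambda>x y. f (?g x \<squnion>\<^bsub>A\<^esub> ?g y),
    neg = \<lambda>x. f (\<sim>\<^bsub>A\<^esub> (?g x))\<rparr>"
  have g: "bij_betw ?g C (univ A)" using f by (rule bij_betw_inv_into)
  have gf: "?g (f x) = x" if "x \<in> univ A" for x
    using f that by (rule bij_betw_inv_into_left)
  have gC: "?g x \<in> univ A" if "x \<in> C" for x using g that by (rule bij_betwE[rule_format])
  have "isomorphic A ?B"
    unfolding isomorphic_def by (rule exI[of _ f]) (simp add: f gf)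
  moreover have "isomorphic ?B A"
    unfolding isomorphic_def
    by (rule exI[of _ ?g]) (simp add: g gf gC meet_closed join_closed neg_closed)
  ultimately show thesis by (rule that)
qed

lemma satisfies_DM4_if_satisfies_DML:
  assumes "\<forall>A\<in>(DML :: 'm::infinite alg set). satisfies A e"
  shows "satisfies DM4 e"
proof -
  have "finite (univ DM4)" by (simp add: DM4_def)
  then obtain B :: "'m alg" where B: "isomorphic DM4 B" "isomorphic B DM4"
    using finite_isomorphic_copy algebra221_DM4 by blast
  \<comment> \<open>The absorption laws are not bipolarly balanced, since \<open>Var 1\<close>
    occurs on one side only, so they are added to transfer the lattice property to the copy.\<close>
  let ?E = "bip_theory \<union> {(Meet (Var 0) (Join (Var 0) (Var 1)), Var 0),
    (Join (Var 0) (Meet (Var 0) (Var 1)), Var 0)}"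
  have "DM4 \<in> models ?E"
    using algebra221_DM4
    by (auto simp: models_def bip_theory_def satisfies_DM4_iff DM4_embedding)
  then have E: "B \<in> models ?E" using B(1) isomorphic_models by blast
  then have "B \<in> models bip_theory" by (simp add: models_def)
  then have "B \<in> BDMBL" using models_subset_BDMBL by blast
  then interpret de_morgan_bisemilattice B by (simp add: BDMBL_def DMBL_def)
  have "distributive_lattice B"
  proof unfold_locales
    fix x y assume xy: "x \<in> univ B" "y \<in> univ B"
    show "x \<sqinter>\<^bsub>B\<^esub> (x \<squnion>\<^bsub>B\<^esub> y) = x"
      using satisfies_triple[OF E, of "Meet (Var 0) (Join (Var 0) (Var 1))" "Var 0" x y x] xy
      by simp
    show "x \<squnion>\<^bsub>B\<^esub> (x \<sqinter>\<^bsub>B\<^esub> y) = x"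
      using satisfies_triple[OF E, of "Join (Var 0) (Meet (Var 0) (Var 1))" "Var 0" x y x] xy
      by simp
  qed
  then have "satisfies B e"
    using assms \<open>B \<in> BDMBL\<close> by (simp add: DML_def BDMBL_def)
  then have "B \<in> models {e}" using algebra221_axioms by (simp add: models_def)
  then show ?thesis using isomorphic_models[OF B(2), of "{e}"] by (simp add: models_def)
qed

text \<open>\<open>DML\<close> and \<open>DM4\<close> validate the same bipolarly balanced
  identities: one direction holds because \<open>DML\<close> lies in \<open>BDMBL\<close>, the other
  because \<open>DML\<close> contains a copy of \<open>DM4\<close>.\<close>

lemma Bip_DML_eq_models: "Bip (DML :: 'm::infinite alg set) = models bip_theory"
proof -
  have "satisfies A e" if "bipolarly_balanced e" "satisfies DM4 e" "A \<in> DML" for e and A :: "'m alg"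
    using that DML_subset_BDMBL BDMBL_eq_models[where 'a = 'm]
    unfolding models_def bip_theory_def by blast
  then have "{e. bipolarly_balanced e \<and> (\<forall>A\<in>(DML :: 'm alg set). satisfies A e)} = bip_theory"
    using satisfies_DM4_if_satisfies_DML unfolding bip_theory_def by blast
  then show ?thesis by (simp add: Bip_def)
qed

lemma generated_variety_DM4_IS3: "generated_variety {DM4, IS3} = models bip_theory"
proof -
  interpret involutive_semilattice IS3 by (rule involutive_semilattice_IS3)
  have "{e. \<forall>B\<in>{DM4, IS3}. satisfies B e} = bip_theory"
    by (auto simp: bip_theory_def satisfies_IS3_iff)
  then show ?thesis
    using algebra221_DM4 algebra221_axioms by (subst generated_variety_eq) auto
qed

theorem theorem4p3:
  shows "(BDMBL :: 'a alg set) = Bip (DML :: 'm::infinite alg set) \<and>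
         (BDMBL :: 'a alg set) = generated_variety {DM4, IS3} \<and>
         (BDMBL :: 'a alg set) = DP_sums TYPE('a) TYPE('a) \<and>
         DP_sums TYPE('i) TYPE('b) \<subseteq> (BDMBL :: 'a alg set)"
  using BDMBL_subset_DP_sums[where 'a = 'a]
    DP_sums_subset_models[where 'i = 'i and 'b = 'b and 'a = 'a]
    DP_sums_subset_models[where 'i = 'a and 'b = 'a and 'a = 'a]
  by (simp add: BDMBL_eq_models Bip_DML_eq_models generated_variety_DM4_IS3 subset_antisym)

end
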